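(* Let $M_0, M_1, \rho, \mu, \sigma, T \in (0,\infty)$ and let $B=(B_t)_{t\ge 0}$ be a standard one-dimensional Brownian motion. Let $S_0$ be the solution on $[0,T]$ of the ordinary differential equation $$dS_0 = \rho\, S_0\, dt,\qquad S_0(0)=M_0,$$ let $S_1$ be the solution on $[0,T]$ of the Itô stochastic differential equation $$dS_1 = \mu\, S_1\, dt + \sigma\, S_1\, dB_t,\qquad S_1(0)=M_1,$$ and let $S(t)=S_0(t)+S_1(t)$ be the total wealth. Then $$\mathbb{E}[S(T)] = M_0\, e^{\rho T} + M_1\, e^{\mu T}.$$
   Context: $M_0$ and $M_1$ are deterministic constants (the initial wealth invested in a riskless bond and in a risky stock). The stochastic differential equation is understood in the usual Itô sense. *)

theory Defs
  imports "HOL-Probability.Probability"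
begin

text \<open>Standard one-dimensional Brownian motion \<open>(B t)\<close>, \<open>t \<ge> 0\<close>, relative to a filtration
  \<open>F\<close>. Every Brownian motion is one relative to its own natural filtration. The index type is
  \<open>real\<close>; nothing is required of \<open>B\<close> at negative times, and a filtration indexed by
  \<open>t \<ge> 0\<close> is extended by \<open>F t = F 0\<close> for \<open>t < 0\<close>. The second parameter of
  \<open>normal_density\<close> is the standard deviation.\<close>

locale brownian_motion = prob_space M + filtration "space M" F
  for M :: "'a measure" and F :: "real \<Rightarrow> 'a measure" +
  fixes B :: "real \<Rightarrow> 'a \<Rightarrow> real"
  assumes sets_F_subset: "\<And>t. sets (F t) \<subseteq> sets M"
    and adapted: "\<And>t. 0 \<le> t \<Longrightarrow> B t \<in> borel_measurable (F t)"
    and starts_at_0: "AE \<omega> in M. B 0 \<omega> = 0"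
    and normal_increments: "\<And>s t. 0 \<le> s \<Longrightarrow> s < t \<Longrightarrow>
      distributed M lborel (\<lambda>\<omega>. B t \<omega> - B s \<omega>) (normal_density 0 (sqrt (t - s)))"
    and indep_increments: "\<And>s t. 0 \<le> s \<Longrightarrow> s < t \<Longrightarrow>
      indep_set (sets (F s)) {(\<lambda>\<omega>. B t \<omega> - B s \<omega>) -` A \<inter> space M | A. A \<in> sets borel}"
    and continuous_paths: "AE \<omega> in M. continuous_on {0..} (\<lambda>t. B t \<omega>)"

definition converges_in_prob ::
  "'a measure \<Rightarrow> (nat \<Rightarrow> 'a \<Rightarrow> real) \<Rightarrow> ('a \<Rightarrow> real) \<Rightarrow> bool" where
  "converges_in_prob M X Y \<longleftrightarrow>
    (\<forall>\<epsilon>>0. (\<lambda>n. measure M {\<omega> \<in> space M. \<epsilon> < \<bar>X n \<omega> - Y \<omega>\<bar>}) \<longlonglongrightarrow> 0)"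

text \<open>The data \<open>n\<close>, \<open>p\<close>, \<open>\<xi>\<close> describe the simple process equal to \<open>\<xi> i\<close> on
  \<open>(p i, p (i + 1)]\<close> for \<open>i < n\<close>, where \<open>0 = p 0 \<le> \<dots> \<le> p n = t\<close>.\<close>

definition simple_process ::
  "(real \<Rightarrow> 'a measure) \<Rightarrow> real \<Rightarrow> nat \<Rightarrow> (nat \<Rightarrow> real) \<Rightarrow> (nat \<Rightarrow> 'a \<Rightarrow> real) \<Rightarrow> bool" where
  "simple_process F t n p \<xi> \<longleftrightarrow>
    p 0 = 0 \<and> p n = t \<and> (\<forall>i<n. p i \<le> p (Suc i)) \<and>
    (\<forall>i<n. \<xi> i \<in> borel_measurable (F (p i)) \<and> (\<exists>C. \<forall>\<omega>\<in>space (F (p i)). \<bar>\<xi> i \<omega>\<bar> \<le> C))"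

definition simple_eval ::
  "nat \<Rightarrow> (nat \<Rightarrow> real) \<Rightarrow> (nat \<Rightarrow> 'a \<Rightarrow> real) \<Rightarrow> real \<Rightarrow> 'a \<Rightarrow> real" where
  "simple_eval n p \<xi> s \<omega> = (\<Sum>i<n. \<xi> i \<omega> * indicator {p i<..p (Suc i)} s)"

definition simple_ito_integral ::
  "(real \<Rightarrow> 'a \<Rightarrow> real) \<Rightarrow> nat \<Rightarrow> (nat \<Rightarrow> real) \<Rightarrow> (nat \<Rightarrow> 'a \<Rightarrow> real) \<Rightarrow> 'a \<Rightarrow> real" where
  "simple_ito_integral B n p \<xi> \<omega> = (\<Sum>i<n. \<xi> i \<omega> * (B (p (Suc i)) \<omega> - B (p i) \<omega>))"

text \<open>The usual class of integrands on \<open>[0, t]\<close>: jointly measurable, adapted and almost surely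
  square integrable in time.\<close>

definition ito_integrand ::
  "'a measure \<Rightarrow> (real \<Rightarrow> 'a measure) \<Rightarrow> real \<Rightarrow> (real \<Rightarrow> 'a \<Rightarrow> real) \<Rightarrow> bool" where
  "ito_integrand M F t H \<longleftrightarrow>
    (\<lambda>(s, \<omega>). H s \<omega>) \<in> borel_measurable (restrict_space borel {0..t} \<Otimes>\<^sub>M M) \<and>
    (\<forall>s\<in>{0..t}. H s \<in> borel_measurable (F s)) \<and>
    (AE \<omega> in M. set_integrable lborel {0..t} (\<lambda>s. (H s \<omega>)\<^sup>2))"

text \<open>The random variable \<open>I\<close> is (a version of) the Ito integral of \<open>H\<close> against \<open>B\<close> over
  \<open>[0, t]\<close>: the limit in probability of the integrals of simple processes approximating \<open>H\<close>
  in \<open>L\<^sup>2[0, t]\<close>, in probability. It is a relation because the integral is determined only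
  up to null sets.\<close>

definition has_ito_integral ::
  "'a measure \<Rightarrow> (real \<Rightarrow> 'a measure) \<Rightarrow> (real \<Rightarrow> 'a \<Rightarrow> real) \<Rightarrow> real \<Rightarrow>
    (real \<Rightarrow> 'a \<Rightarrow> real) \<Rightarrow> ('a \<Rightarrow> real) \<Rightarrow> bool" where
  "has_ito_integral M F B t H I \<longleftrightarrow>
    ito_integrand M F t H \<and> I \<in> borel_measurable M \<and>
    (\<exists>n p \<xi>. (\<forall>k. simple_process F t (n k) (p k) (\<xi> k)) \<and>
      converges_in_prob M
        (\<lambda>k \<omega>. LBINT s:{0..t}. (simple_eval (n k) (p k) (\<xi> k) s \<omega> - H s \<omega>)\<^sup>2) (\<lambda>_. 0) \<and>
      converges_in_prob M (\<lambda>k. simple_ito_integral B (n k) (p k) (\<xi> k)) I)"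

text \<open>\<open>X\<close> solves \<open>dX = b(X) dt + a(X) dB\<close> on \<open>[0, T]\<close> with \<open>X 0 = x\<close>. Joint measurability
  and almost sure square integrability of \<open>a(X)\<close> are part of \<open>has_ito_integral\<close>.\<close>

definition ito_sde_solution ::
  "'a measure \<Rightarrow> (real \<Rightarrow> 'a measure) \<Rightarrow> (real \<Rightarrow> 'a \<Rightarrow> real) \<Rightarrow>
    (real \<Rightarrow> real) \<Rightarrow> (real \<Rightarrow> real) \<Rightarrow> real \<Rightarrow> real \<Rightarrow> (real \<Rightarrow> 'a \<Rightarrow> real) \<Rightarrow> bool" where
  "ito_sde_solution M F B b a x T X \<longleftrightarrow>
    (\<forall>t\<in>{0..T}. X t \<in> borel_measurable (F t)) \<and>
    (AE \<omega> in M. continuous_on {0..T} (\<lambda>t. X t \<omega>)) \<and>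
    (AE \<omega> in M. X 0 \<omega> = x) \<and>
    (AE \<omega> in M. set_integrable lborel {0..T} (\<lambda>s. b (X s \<omega>))) \<and>
    (\<forall>t\<in>{0..T}. \<exists>I. has_ito_integral M F B t (\<lambda>s \<omega>. a (X s \<omega>)) I \<and>
      (AE \<omega> in M. X t \<omega> = x + (LBINT s:{0..t}. b (X s \<omega>)) + I \<omega>))"

end

theory Submission
  imports Defs
begin

text \<open>Since the Ito integral in the equation for \<open>S1\<close> is only a limit in probability, its mean has
  to be shown to vanish, and this needs \<open>E (S1 t)\<^sup>2\<close> to be bounded in \<open>t\<close>. Put
  \<open>H = \<sigma> * S1\<close>. The Ito integral of the continuous process \<open>H\<close> is the limit of its left-point sums
  over uniform partitions. On the event that \<open>\<bar>H\<bar>\<close> stays below \<open>N\<close> up to time \<open>t\<close>, these sums agree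
  with those of \<open>H\<close> stopped at level \<open>N\<close>, to which the isometry for simple processes applies. With
  Fatou's lemma this gives an integral inequality for the second moment of the stopped process,
  hence by Gronwall's lemma a bound which does not depend on \<open>N\<close>. Then the integral has mean zero,
  and \<open>E (H t) = \<sigma> * M1 + \<mu> * (\<integral>s\<le>t. E (H s))\<close>, which determines \<open>E (H t)\<close> by a second application
  of Gronwall's lemma.\<close>

section \<open>Gronwall's lemma\<close>

text \<open>The definition of the Ito integral provides some approximating sequence of simple
  processes and says nothing about its shape or its moments. Passing to left-point sums therefore
  requires the limit to be independent of the sequence, and this has to be shown before any second
  moment of \<open>H\<close> is known to be finite. It rests on an estimate in probability for
  simple integrals in which only the energy of the integrand enters. Simple integrands must moreover
  be bounded, which \<open>H\<close> need not be; so the left-point sums that approximate its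
  integral are stopped at a level that grows with the number of cells. Multiplying the equation by
  \<open>\<sigma>\<close> makes the solution and the Ito integrand the same process, so that the
  isometry turns the equation into an inequality for a single second moment. Stopping also supplies
  the a priori boundedness that Gronwall's lemma asks for.\<close>

lemma integral_exp_Icc:
  fixes c t :: real
  assumes "c \<noteq> 0" "0 \<le> t"
  shows "set_integrable lborel {0..t} (\<lambda>s. exp (c * s))"
    and "(LBINT s:{0..t}. exp (c * s)) = (exp (c * t) - 1) / c"
proof -
  show "set_integrable lborel {0..t} (\<lambda>s. exp (c * s))"
    by (intro borel_integrable_atLeastAtMost') (auto intro!: continuous_intros)
  have "(\<integral>s. exp (c * s) * indicator {0..t} s \<partial>lborel) = exp (c * t) / c - exp (c * 0) / c"
    by (rule integral_FTC_Icc_real)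
      (use assms in \<open>auto intro!: derivative_eq_intros continuous_intros\<close>)
  then show "(LBINT s:{0..t}. exp (c * s)) = (exp (c * t) - 1) / c"
    by (simp add: set_lebesgue_integral_def mult.commute diff_divide_distrib)
qed

text \<open>With \<open>S\<close> the supremum of \<open>g t * exp (- 2 * b * t)\<close>, the hypothesis gives
  \<open>S \<le> a + S / 2\<close>.\<close>

lemma gronwall_bounded:
  fixes g :: "real \<Rightarrow> real"
  assumes g: "set_integrable lborel {0..T} g"
    and nonneg: "\<And>t. t \<in> {0..T} \<Longrightarrow> 0 \<le> g t"
    and bounded: "\<And>t. t \<in> {0..T} \<Longrightarrow> g t \<le> C"
    and ab: "0 \<le> a" "0 < b"
    and le: "\<And>t. t \<in> {0..T} \<Longrightarrow> g t \<le> a + b * (LBINT s:{0..t}. g s)"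
    and t: "t \<in> {0..T}"
  shows "g t \<le> 2 * a * exp (2 * b * t)"
proof -
  define h where "h s = g s * exp (- (2 * b * s))" for s
  define S where "S = Sup (h ` {0..T})"
  have "h s \<le> C" if "s \<in> {0..T}" for s
  proof -
    have "h s \<le> g s * 1"
      unfolding h_def using that nonneg[OF that] ab by (intro mult_left_mono) auto
    then show ?thesis using bounded[OF that] by simp
  qed
  then have bdd: "bdd_above (h ` {0..T})" by (intro bdd_aboveI[of _ C]) auto
  have h_le: "h s \<le> S" if "s \<in> {0..T}" for s
    unfolding S_def using that bdd by (intro cSup_upper) auto
  have g_le: "g s \<le> S * exp (2 * b * s)" if "s \<in> {0..T}" for s
    using h_le[OF that] by (simp add: h_def exp_minus field_simps)
  have "0 \<le> h t" using nonneg[OF t] by (simp add: h_def)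
  with h_le[OF t] have S0: "0 \<le> S" by simp
  have step: "h s \<le> a + S / 2" if s: "s \<in> {0..T}" for s
  proof -
    have "(LBINT r:{0..s}. g r) \<le> (LBINT r:{0..s}. S * exp (2 * b * r))"
      using s ab integral_exp_Icc(1)[of "2 * b" s]
      by (intro set_integral_mono set_integrable_subset[OF g] g_le) auto
    also have "\<dots> = S * ((exp (2 * b * s) - 1) / (2 * b))"
      using s ab integral_exp_Icc(2)[of "2 * b" s] by simp
    \<comment> \<open>The weight decays at twice the rate \<open>b\<close>, so
      \<open>b / (2 * b)\<close> leaves the factor 1/2; the term \<open>- S / 2\<close> is dropped
      because \<open>0 \<le> S\<close>.\<close>
    also have "b * \<dots> \<le> S / 2 * exp (2 * b * s)"
      using ab S0 by (simp add: field_simps)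
    finally have "g s \<le> a + S / 2 * exp (2 * b * s)"
      using le[OF s] ab by (smt (verit) mult_left_mono)
    also have "\<dots> \<le> (a + S / 2) * exp (2 * b * s)"
      using ab s by (simp add: algebra_simps mult_le_cancel_left1)
    finally show ?thesis by (simp add: h_def exp_minus field_simps)
  qed
  have "S \<le> a + S / 2" unfolding S_def
    using t step by (intro cSup_least) (auto simp: S_def)
  then have "S \<le> 2 * a" by simp
  then have "S * exp (2 * b * t) \<le> 2 * a * exp (2 * b * t)"
    by (intro mult_right_mono) auto
  with g_le[OF t] show ?thesis by linarith
qed

section \<open>Convergence in probability\<close>

context prob_space
begin

text \<open>The union bound, for splitting a deviation into two smaller ones. The implication is
  almost sure because the energy estimates to which it is applied hold off a null set.\<close>

lemma prob_union_le:
  assumes "AE x in M. P x \<longrightarrow> Q x \<or> R x"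
    and "{x \<in> space M. Q x} \<in> events" "{x \<in> space M. R x} \<in> events"
  shows "prob {x \<in> space M. P x} \<le> prob {x \<in> space M. Q x} + prob {x \<in> space M. R x}"
proof -
  have "prob {x \<in> space M. P x} \<le> prob ({x \<in> space M. Q x} \<union> {x \<in> space M. R x})"
    using assms by (intro finite_measure_mono_AE) auto
  also have "\<dots> \<le> prob {x \<in> space M. Q x} + prob {x \<in> space M. R x}"
    using assms by (intro measure_Un_le) auto
  finally show ?thesis .
qed

text \<open>For fixed \<epsilon> the indicators of the deviation events tend to 0 almost surely and
  are dominated by 1.\<close>

lemma converges_in_prob_AE:
  assumes [measurable]: "\<And>k. X k \<in> borel_measurable M" "Y \<in> borel_measurable M"
    and lim: "AE x in M. (\<lambda>k. X k x) \<longlonglongrightarrow> Y x"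
  shows "converges_in_prob M X Y"
  unfolding converges_in_prob_def
proof (intro allI impI)
  fix \<epsilon> :: real assume e: "0 < \<epsilon>"
  let ?A = "\<lambda>k. {x \<in> space M. \<epsilon> < \<bar>X k x - Y x\<bar>}"
  have "(\<lambda>k. \<integral>x. indicator (?A k) x \<partial>M :: real) \<longlonglongrightarrow> (\<integral>x. 0 \<partial>M)"
  proof (rule integral_dominated_convergence[where w="\<lambda>_. 1"])
    show "AE x in M. (\<lambda>k. indicator (?A k) x :: real) \<longlonglongrightarrow> 0"
      using lim
    proof eventually_elim
      case (elim x)
      have "eventually (\<lambda>k. dist (X k x) (Y x) < \<epsilon>) sequentially"
        using tendstoD[OF elim e] .
      then have "eventually (\<lambda>k. indicator (?A k) x = (0::real)) sequentially"
        by eventually_elim (auto simp: dist_real_def indicator_def)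
      then show ?case by (rule tendsto_eventually)
    qed
  qed (auto split: split_indicator)
  then show "(\<lambda>k. prob (?A k)) \<longlonglongrightarrow> 0"
    by simp
qed

text \<open>Transfers a limit from sums stopped at a growing level to sums stopped at a fixed level,
  restricted to an event on which the two agree once the growing level is high enough.\<close>

lemma converges_in_prob_dominated:
  assumes X: "converges_in_prob M X Y"
    and [measurable]: "\<And>k. X k \<in> borel_measurable M" "Y \<in> borel_measurable M"
    and ev: "\<forall>\<^sub>F k in sequentially. AE x in M. \<bar>X' k x - Y' x\<bar> \<le> \<bar>X k x - Y x\<bar>"
  shows "converges_in_prob M X' Y'"
  unfolding converges_in_prob_def
proof (intro allI impI)
  fix \<epsilon> :: real assume e: "0 < \<epsilon>"
  show "(\<lambda>k. prob {x \<in> space M. \<epsilon> < \<bar>X' k x - Y' x\<bar>}) \<longlonglongrightarrow> 0"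
  proof (rule tendsto_sandwich[OF _ _ tendsto_const])
    show "(\<lambda>k. prob {x \<in> space M. \<epsilon> < \<bar>X k x - Y x\<bar>}) \<longlonglongrightarrow> 0"
      using X e by (simp add: converges_in_prob_def)
    show "\<forall>\<^sub>F k in sequentially. prob {x \<in> space M. \<epsilon> < \<bar>X' k x - Y' x\<bar>}
      \<le> prob {x \<in> space M. \<epsilon> < \<bar>X k x - Y x\<bar>}"
      using ev
    proof eventually_elim
      case (elim k)
      then have "AE x in M. \<epsilon> < \<bar>X' k x - Y' x\<bar> \<longrightarrow> \<epsilon> < \<bar>X k x - Y x\<bar>"
        by eventually_elim auto
      then show ?case by (intro finite_measure_mono_AE) auto
    qed
  qed simp
qed

lemma integrable_indicator_event [simp]: "A \<in> events \<Longrightarrow> integrable M (indicator A :: 'a \<Rightarrow> real)"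
  by (intro integrable_real_indicator) (simp_all add: emeasure_eq_measure)

text \<open>Convergence in probability makes the truncated distance
  \<open>min 1 \<bar>X k - Y\<bar>\<close> tend to 0 in mean, and convergence in mean yields an
  almost surely convergent subsequence.\<close>

lemma converges_in_prob_AE_subseq:
  assumes X: "converges_in_prob M X Y"
    and [measurable]: "\<And>k. X k \<in> borel_measurable M" "Y \<in> borel_measurable M"
  obtains r where "strict_mono (r :: nat \<Rightarrow> nat)" "AE x in M. (\<lambda>k. X (r k) x) \<longlonglongrightarrow> Y x"
proof -
  define u where "u k x = min 1 \<bar>X k x - Y x\<bar>" for k x
  have [measurable]: "u k \<in> borel_measurable M" for k unfolding u_def by measurable
  have int: "integrable M (u k)" for k
    by (rule integrable_const_bound[of _ 1]) (auto simp: u_def)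
  have "(\<lambda>k. \<integral>x. norm (u k x) \<partial>M) \<longlonglongrightarrow> 0"
  proof (rule LIMSEQ_I)
    fix e :: real assume e: "0 < e"
    have "eventually (\<lambda>k. prob {x \<in> space M. e / 2 < \<bar>X k x - Y x\<bar>} < e / 2) sequentially"
      using X[unfolded converges_in_prob_def, rule_format, of "e / 2"] e
      by (intro order_tendstoD(2)[of _ 0]) simp_all
    then have "eventually (\<lambda>k. norm ((\<integral>x. norm (u k x) \<partial>M) - 0) < e) sequentially"
    proof eventually_elim
      case (elim k)
      \<comment> \<open>\<open>u k\<close> is at most 1 on the deviation event and at most
        \<open>e / 2\<close> off it.\<close>
      have "(\<integral>x. norm (u k x) \<partial>M)
        \<le> (\<integral>x. e / 2 + indicator {x \<in> space M. e / 2 < \<bar>X k x - Y x\<bar>} x \<partial>M)"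
      proof (rule integral_mono)
        fix x assume x: "x \<in> space M"
        show "norm (u k x) \<le> e / 2 + indicator {x \<in> space M. e / 2 < \<bar>X k x - Y x\<bar>} x"
          using e x by (cases "e / 2 < \<bar>X k x - Y x\<bar>") (auto simp: u_def min_def)
      qed (use int[of k] in simp_all)
      also have "\<dots> = e / 2 + prob {x \<in> space M. e / 2 < \<bar>X k x - Y x\<bar>}"
        by (subst Bochner_Integration.integral_add) (auto simp: prob_space)
      finally show ?case using elim by simp
    qed
    then show "\<exists>n0. \<forall>n\<ge>n0. norm ((\<integral>x. norm (u n x) \<partial>M) - 0) < e"
      by (simp add: eventually_sequentially)
  qed
  from tendsto_L1_AE_subseq[OF int this] obtain r where r: "strict_mono r"
    and lim: "AE x in M. (\<lambda>k. u (r k) x) \<longlonglongrightarrow> 0" by auto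
  have "AE x in M. (\<lambda>k. X (r k) x) \<longlonglongrightarrow> Y x"
    using lim
  proof eventually_elim
    case (elim x)
    then have "eventually (\<lambda>k. u (r k) x < 1) sequentially" by (rule order_tendstoD) simp
    then have "eventually (\<lambda>k. \<bar>X (r k) x - Y x\<bar> = u (r k) x) sequentially"
      by eventually_elim (auto simp: u_def)
    then have "(\<lambda>k. \<bar>X (r k) x - Y x\<bar>) \<longlonglongrightarrow> 0"
      using elim by (simp add: tendsto_cong)
    then show ?case by (simp add: LIM_zero_iff tendsto_rabs_zero_iff)
  qed
  with r show ?thesis by (rule that)
qed

text \<open>Fatou's lemma along an almost surely convergent subsequence. The bounds
  \<open>c k\<close> may depend on \<open>k\<close> because in the application they are Riemann
  sums.\<close>

lemma converges_in_prob_square_le: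
  assumes X: "converges_in_prob M X Y"
    and [measurable]: "\<And>k. X k \<in> borel_measurable M" "Y \<in> borel_measurable M"
    and int: "\<And>k. integrable M (\<lambda>x. (X k x)\<^sup>2)"
    and le: "\<And>k. expectation (\<lambda>x. (X k x)\<^sup>2) \<le> c k"
    and c: "c \<longlonglongrightarrow> C"
  shows "integrable M (\<lambda>x. (Y x)\<^sup>2)" and "expectation (\<lambda>x. (Y x)\<^sup>2) \<le> C"
proof -
  obtain r where r: "strict_mono r" and lim: "AE x in M. (\<lambda>k. X (r k) x) \<longlonglongrightarrow> Y x"
    by (rule converges_in_prob_AE_subseq[OF X]) auto
  have c_nonneg: "0 \<le> c k" for k using le[of k] by (smt (verit) Bochner_Integration.integral_nonneg zero_le_power2)
  then have C: "0 \<le> C" using c by (intro LIMSEQ_le_const) auto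
  have "(\<integral>\<^sup>+x. ennreal ((Y x)\<^sup>2) \<partial>M) = (\<integral>\<^sup>+x. liminf (\<lambda>k. ennreal ((X (r k) x)\<^sup>2)) \<partial>M)"
  proof (rule nn_integral_cong_AE)
    show "AE x in M. ennreal ((Y x)\<^sup>2) = liminf (\<lambda>k. ennreal ((X (r k) x)\<^sup>2))"
      using lim
    proof eventually_elim
      case (elim x)
      have "(\<lambda>k. ennreal ((X (r k) x)\<^sup>2)) \<longlonglongrightarrow> ennreal ((Y x)\<^sup>2)"
        using elim by (intro tendsto_ennrealI tendsto_power)
      then show ?case by (intro lim_imp_Liminf[symmetric]) simp_all
    qed
  qed
  also have "\<dots> \<le> liminf (\<lambda>k. \<integral>\<^sup>+x. ennreal ((X (r k) x)\<^sup>2) \<partial>M)"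
    by (rule nn_integral_liminf) measurable
  also have "\<dots> \<le> liminf (\<lambda>k. ennreal (c (r k)))"
    using le int by (intro Liminf_mono always_eventually allI)
      (simp add: nn_integral_eq_integral ennreal_leI)
  also have "\<dots> = ennreal C"
    using LIMSEQ_subseq_LIMSEQ[OF c r] by (intro lim_imp_Liminf) (auto simp: o_def)
  finally have *: "(\<integral>\<^sup>+x. ennreal ((Y x)\<^sup>2) \<partial>M) \<le> ennreal C" .
  then show "integrable M (\<lambda>x. (Y x)\<^sup>2)"
    by (intro integrableI_bounded) (auto simp: le_less_trans[OF _ ennreal_less_top])
  show "expectation (\<lambda>x. (Y x)\<^sup>2) \<le> C"
    using C * by (rule integral_real_bounded)
qed

lemma integrable_square_imp_integrable:
  assumes [measurable]: "f \<in> borel_measurable M" and "integrable M (\<lambda>x. (f x)\<^sup>2)"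
  shows "integrable M (f :: 'a \<Rightarrow> real)"
proof (rule Bochner_Integration.integrable_bound)
  show "integrable M (\<lambda>x. 1 + (f x)\<^sup>2)"
    using assms(2) by (intro Bochner_Integration.integrable_add integrable_const)
  show "AE x in M. norm (f x) \<le> norm (1 + (f x)\<^sup>2)"
  proof (rule AE_I2)
    fix x
    have "0 \<le> (\<bar>f x\<bar> - 1)\<^sup>2" by simp
    then have "2 * \<bar>f x\<bar> \<le> 1 + (f x)\<^sup>2" by (simp add: power2_diff)
    then show "norm (f x) \<le> norm (1 + (f x)\<^sup>2)" by simp
  qed
qed simp

text \<open>A uniform bound on second moments gives uniform integrability. Quantitatively, the
  difference \<open>y\<close> satisfies \<open>\<bar>y\<bar> \<le> \<epsilon>\<close> off the
  deviation event and \<open>\<bar>y\<bar> \<le> \<epsilon> * y\<^sup>2 + 1 / \<epsilon>\<close> on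
  it.\<close>

lemma converges_in_prob_expectation:
  assumes X: "converges_in_prob M X Y"
    and [measurable]: "\<And>k. X k \<in> borel_measurable M" "Y \<in> borel_measurable M"
    and int: "\<And>k. integrable M (\<lambda>x. (X k x)\<^sup>2)"
    and le: "\<And>k. expectation (\<lambda>x. (X k x)\<^sup>2) \<le> C"
  shows "(\<lambda>k. expectation (X k)) \<longlonglongrightarrow> expectation Y"
proof -
  note Y = converges_in_prob_square_le[OF X assms(2,3) int le tendsto_const]
  have iX: "integrable M (X k)" for k using int by (rule integrable_square_imp_integrable[rotated]) simp_all
  have iY: "integrable M Y" using Y(1) by (rule integrable_square_imp_integrable[rotated]) simp_all
  have C: "0 \<le> C" using le[of 0] by (smt (verit) Bochner_Integration.integral_nonneg zero_le_power2)
  define A where "A \<epsilon> k = {x \<in> space M. \<epsilon> < \<bar>X k x - Y x\<bar>}" for \<epsilon> k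
  have [measurable]: "A \<epsilon> k \<in> events" for \<epsilon> k unfolding A_def by measurable
  have bound: "\<bar>expectation (X k) - expectation Y\<bar> \<le> \<epsilon> + \<epsilon> * (4 * C) + prob (A \<epsilon> k) / \<epsilon>"
    if e: "0 < \<epsilon>" for \<epsilon> k
  proof -
    have "\<bar>expectation (X k) - expectation Y\<bar> = \<bar>\<integral>x. X k x - Y x \<partial>M\<bar>"
      using iX iY by simp
    also have "\<dots> \<le> (\<integral>x. \<bar>X k x - Y x\<bar> \<partial>M)" by (rule integral_abs_bound)
    also have "\<dots> \<le> (\<integral>x. \<epsilon> + \<epsilon> * (2 * (X k x)\<^sup>2 + 2 * (Y x)\<^sup>2) + indicator (A \<epsilon> k) x / \<epsilon> \<partial>M)"
    proof (rule integral_mono)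
      show "integrable M (\<lambda>x. \<epsilon> + \<epsilon> * (2 * (X k x)\<^sup>2 + 2 * (Y x)\<^sup>2) + indicator (A \<epsilon> k) x / \<epsilon>)"
        using int Y(1) by (intro Bochner_Integration.integrable_add integrable_mult_right
            integrable_divide) simp_all
      fix x assume x: "x \<in> space M"
      define y where "y = X k x - Y x"
      have 1: "y\<^sup>2 \<le> 2 * (X k x)\<^sup>2 + 2 * (Y x)\<^sup>2"
        using zero_le_power2[of "X k x + Y x"] by (simp add: y_def power2_sum power2_diff)
      \<comment> \<open>Expanding this square bounds \<open>2 * \<epsilon> * \<bar>y\<bar>\<close>;
        giving away one of the two copies of \<open>\<epsilon> * \<bar>y\<bar>\<close> and dividing
        by \<epsilon> yields the estimate for large \<open>y\<close>.\<close>
      have "0 \<le> (\<epsilon> * \<bar>y\<bar> - 1)\<^sup>2" by simp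
      then have "2 * \<epsilon> * \<bar>y\<bar> \<le> \<epsilon>\<^sup>2 * y\<^sup>2 + 1"
        by (simp add: power2_diff power_mult_distrib)
      moreover have "\<epsilon>\<^sup>2 * y\<^sup>2 = (\<epsilon> * y\<^sup>2) * \<epsilon>" "2 * \<epsilon> * \<bar>y\<bar> = 2 * (\<bar>y\<bar> * \<epsilon>)"
        by (simp_all add: power2_eq_square)
      moreover have "0 \<le> \<bar>y\<bar> * \<epsilon>" using e by simp
      ultimately have "\<bar>y\<bar> * \<epsilon> \<le> (\<epsilon> * y\<^sup>2) * \<epsilon> + 1" by linarith
      then have 2: "\<bar>y\<bar> \<le> \<epsilon> * y\<^sup>2 + 1 / \<epsilon>"
        using e by (simp add: field_simps)
      have 3: "\<epsilon> * y\<^sup>2 \<le> \<epsilon> * (2 * (X k x)\<^sup>2 + 2 * (Y x)\<^sup>2)"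
        using 1 e by (intro mult_left_mono) auto
      have 4: "0 \<le> \<epsilon> * y\<^sup>2" using e by simp
      show "\<bar>X k x - Y x\<bar> \<le> \<epsilon> + \<epsilon> * (2 * (X k x)\<^sup>2 + 2 * (Y x)\<^sup>2) + indicator (A \<epsilon> k) x / \<epsilon>"
      proof (cases "x \<in> A \<epsilon> k")
        case True
        then show ?thesis using 2 3 e unfolding y_def by (simp only: indicator_simps)
      next
        case False
        then have "\<bar>y\<bar> \<le> \<epsilon>" using x by (simp add: A_def y_def)
        moreover have "indicator (A \<epsilon> k) x = (0::real)" using False by simp
        ultimately show ?thesis using order_trans[OF 4 3] e unfolding y_def
          by (simp only: div_0 add_0_right)
      qed
    qed (use iX iY in auto)
    also have "\<dots> = \<epsilon> + \<epsilon> * (2 * expectation (\<lambda>x. (X k x)\<^sup>2) + 2 * expectation (\<lambda>x. (Y x)\<^sup>2))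
        + prob (A \<epsilon> k) / \<epsilon>"
      using int Y(1) by (simp add: prob_space)
    also have "\<dots> \<le> \<epsilon> + \<epsilon> * (4 * C) + prob (A \<epsilon> k) / \<epsilon>"
      using e le[of k] Y(2) by (auto intro!: mult_left_mono)
    finally show ?thesis .
  qed
  show ?thesis
  proof (rule LIMSEQ_I)
    fix e :: real assume e: "0 < e"
    \<comment> \<open>Chosen so that the two terms of \<open>bound\<close> without a probability add
      up to \<open>e / 2\<close>; the remaining term drops below \<open>e / 2\<close> once the
      probability is below \<open>\<epsilon> * (e / 2)\<close>.\<close>
    define \<epsilon> where "\<epsilon> = e / 2 / (1 + 4 * C)"
    have \<epsilon>: "0 < \<epsilon>" using e C by (simp add: \<epsilon>_def)
    have eq: "\<epsilon> + \<epsilon> * (4 * C) = e / 2"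
    proof -
      have "1 + 4 * C \<noteq> 0" using C by simp
      from iffD1[OF nonzero_eq_divide_eq[OF this] \<epsilon>_def] have "\<epsilon> * (1 + 4 * C) = e / 2" .
      then show ?thesis by (simp add: algebra_simps)
    qed
    have "eventually (\<lambda>k. prob (A \<epsilon> k) < \<epsilon> * (e / 2)) sequentially"
      using X[unfolded converges_in_prob_def, rule_format, OF \<epsilon>] e \<epsilon>
      by (intro order_tendstoD(2)[of _ 0]) (simp_all add: A_def)
    then have "eventually (\<lambda>k. norm (expectation (X k) - expectation Y) < e) sequentially"
    proof eventually_elim
      case (elim k)
      then have "prob (A \<epsilon> k) / \<epsilon> < e / 2" using \<epsilon> by (simp add: field_simps)
      with bound[OF \<epsilon>, of k] eq show ?case unfolding diff_0_right real_norm_def by linarith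
    qed
    then show "\<exists>n0. \<forall>n\<ge>n0. norm (expectation (X n) - expectation Y) < e"
      by (simp add: eventually_sequentially)
  qed
qed

end

section \<open>Simple processes\<close>

lemma partition_mono:
  fixes p :: "nat \<Rightarrow> real"
  assumes "\<forall>i<n. p i \<le> p (Suc i)" "i \<le> j" "j \<le> n"
  shows "p i \<le> p j"
  using assms(2,3)
proof (induction j rule: dec_induct)
  case (step m)
  then show ?case using assms(1) order_trans[of "p i" "p m" "p (Suc m)"] by simp
qed simp

lemma partition_cell:
  fixes p :: "nat \<Rightarrow> real"
  assumes "p 0 < s" "s \<le> p n"
  obtains i where "i < n" "p i < s" "s \<le> p (Suc i)"
proof -
  have "\<exists>i<n. p i < s \<and> s \<le> p (Suc i)"
    using assms
  proof (induction n)
    case (Suc n)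
    then show ?case by (cases "s \<le> p n") (auto simp: less_Suc_eq)
  qed simp
  with that show ?thesis by blast
qed

text \<open>With \<open>q\<close> a point of a coarser partition, this is what places each cell of a
  refinement inside a single cell of the coarser one.\<close>

lemma partition_gap:
  fixes r :: "nat \<Rightarrow> real"
  assumes r: "\<forall>j<L. r j \<le> r (Suc j)" and q: "q \<in> r ` {..L}" and j: "j < L"
  shows "q \<le> r j \<or> r (Suc j) \<le> q"
proof -
  obtain a where a: "a \<le> L" "q = r a" using q by auto
  show ?thesis
  proof (cases "a \<le> j")
    case True
    then show ?thesis using partition_mono[of L r a j] r j a by auto
  next
    case False
    then show ?thesis using partition_mono[of L r "Suc j" a] r j a by auto
  qed
qed

text \<open>Used to list the union of two partitions in increasing order. Since \<open>{..L}\<close>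
  has \<open>L + 1\<close> elements, \<open>L\<close> is one less than the number of points.\<close>

lemma finite_set_partition:
  fixes A :: "real set"
  assumes "finite A" "A \<noteq> {}"
  obtains L :: nat and r where "r ` {..L} = A" "\<forall>j<L. r j \<le> r (Suc j)"
proof
  let ?xs = "sorted_list_of_set A"
  have pos: "0 < card A" using assms by (simp add: card_gt_0_iff)
  have "{..card A - 1} = {..<length ?xs}"
    using pos by auto
  moreover have "(\<lambda>i. ?xs ! i) ` {..<length ?xs} = set ?xs"
    by (simp only: set_conv_nth) auto
  ultimately show "(\<lambda>i. ?xs ! i) ` {..card A - 1} = A"
    using assms by simp
  show "\<forall>j<card A - 1. ?xs ! j \<le> ?xs ! Suc j"
    using assms by (auto intro!: sorted_nth_mono)
qed

lemma simple_eval_cell: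
  assumes "\<forall>i<n. p i \<le> p (Suc i)" "i < n" "p i < s" "s \<le> p (Suc i)"
  shows "simple_eval n p \<xi> s \<omega> = \<xi> i \<omega>"
proof -
  have "\<xi> j \<omega> * indicator {p j<..p (Suc j)} s = (if j = i then \<xi> i \<omega> else 0)" if "j < n" for j
  proof (cases "j < i")
    case True
    then show ?thesis using partition_mono[of n p "Suc j" i] assms by auto
  next
    case False
    then show ?thesis using partition_mono[of n p "Suc i" j] assms that
      by (cases "j = i") auto
  qed
  then have "simple_eval n p \<xi> s \<omega> = (\<Sum>j<n. if j = i then \<xi> i \<omega> else 0)"
    unfolding simple_eval_def by (intro sum.cong) auto
  then show ?thesis using assms(2) by simp
qed

lemma simple_eval_outside:
  assumes "\<forall>i<n. p i \<le> p (Suc i)" "s \<notin> {p 0<..p n}"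
  shows "simple_eval n p \<xi> s \<omega> = 0"
  unfolding simple_eval_def
proof (intro sum.neutral ballI)
  fix i assume "i \<in> {..<n}"
  then show "\<xi> i \<omega> * indicator {p i<..p (Suc i)} s = 0"
    using assms partition_mono[of n p 0 i] partition_mono[of n p "Suc i" n] by auto
qed

lemma simple_eval_eqI:
  assumes p: "\<forall>i<n. p i \<le> p (Suc i)"
    and out: "s \<notin> {p 0<..p n} \<Longrightarrow> f = 0"
    and cell: "\<And>i. i < n \<Longrightarrow> p i < s \<Longrightarrow> s \<le> p (Suc i) \<Longrightarrow> f = \<xi> i \<omega>"
  shows "simple_eval n p \<xi> s \<omega> = f"
proof (cases "s \<in> {p 0<..p n}")
  case True
  then obtain i where "i < n" "p i < s" "s \<le> p (Suc i)" using partition_cell[of p s n] by auto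
  then show ?thesis using cell simple_eval_cell[of n p i s \<xi> \<omega>, OF p] by simp
next
  case False
  then show ?thesis using out simple_eval_outside[OF p] by metis
qed

text \<open>Cells are open on the left and closed on the right, so the value on a fine cell is read
  off at its right end point; its left end point may still belong to the preceding coarse
  cell.\<close>

lemma simple_eval_refine:
  assumes p: "\<forall>i<n. p i \<le> p (Suc i)" and r: "\<forall>j<L. r j \<le> r (Suc j)"
    and ends: "r 0 = p 0" "r L = p n" and sub: "p ` {..n} \<subseteq> r ` {..L}"
  shows "simple_eval L r (\<lambda>j. simple_eval n p \<xi> (r (Suc j))) s \<omega> = simple_eval n p \<xi> s \<omega>"
proof (rule simple_eval_eqI[OF r])
  assume "s \<notin> {r 0<..r L}"
  then show "simple_eval n p \<xi> s \<omega> = 0" using ends by (intro simple_eval_outside p) auto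
next
  fix j assume j: "j < L" "r j < s" "s \<le> r (Suc j)"
  have "p 0 < s" "s \<le> p n"
    using j partition_mono[of L r 0 j] partition_mono[of L r "Suc j" L] r
    unfolding ends[symmetric] by auto
  then obtain i where i: "i < n" "p i < s" "s \<le> p (Suc i)" by (rule partition_cell)
  have "p i \<in> r ` {..L}" "p (Suc i) \<in> r ` {..L}" using sub i by auto
  from partition_gap[OF r this(1) j(1)] partition_gap[OF r this(2) j(1)]
  have "simple_eval n p \<xi> (r (Suc j)) \<omega> = \<xi> i \<omega>"
    using i j by (intro simple_eval_cell p) auto
  then show "simple_eval n p \<xi> s \<omega> = simple_eval n p \<xi> (r (Suc j)) \<omega>"
    using i by (simp add: simple_eval_cell[OF p])
qed

text \<open>Clamping to \<open>[p i, p (i + 1)]\<close> turns the increments of \<open>B\<close> over the fine cells contained in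
  a coarse cell into a telescoping sum over all fine cells.\<close>

lemma simple_ito_integral_refine:
  assumes p: "\<forall>i<n. p i \<le> p (Suc i)" and r: "\<forall>j<L. r j \<le> r (Suc j)"
    and ends: "r 0 = p 0" "r L = p n" and sub: "p ` {..n} \<subseteq> r ` {..L}"
  shows "simple_ito_integral B L r (\<lambda>j. simple_eval n p \<xi> (r (Suc j))) \<omega>
    = simple_ito_integral B n p \<xi> \<omega>"
proof -
  have telescope: "(\<Sum>j<L. indicator {p i<..p (Suc i)} (r (Suc j)) * (B (r (Suc j)) \<omega> - B (r j) \<omega>))
      = B (p (Suc i)) \<omega> - B (p i) \<omega>" if i: "i < n" for i
  proof -
    define c where "c x = max (p i) (min (p (Suc i)) x)" for x
    have "indicator {p i<..p (Suc i)} (r (Suc j)) * (B (r (Suc j)) \<omega> - B (r j) \<omega>)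
        = B (c (r (Suc j))) \<omega> - B (c (r j)) \<omega>" if j: "j < L" for j
    proof -
      have "p i \<in> r ` {..L}" "p (Suc i) \<in> r ` {..L}" using sub i by auto
      from partition_gap[OF r this(1) j] partition_gap[OF r this(2) j]
      show ?thesis using r[rule_format, OF j] p[rule_format, OF i] by (auto simp: c_def indicator_def max_def min_def)
    qed
    then have "(\<Sum>j<L. indicator {p i<..p (Suc i)} (r (Suc j)) * (B (r (Suc j)) \<omega> - B (r j) \<omega>))
      = (\<Sum>j<L. B (c (r (Suc j))) \<omega> - B (c (r j)) \<omega>)" by (intro sum.cong) auto
    also have "\<dots> = B (c (r L)) \<omega> - B (c (r 0)) \<omega>" by (rule sum_lessThan_telescope)
    also have "c (r L) = p (Suc i)"
      using partition_mono[of n p "Suc i" n] p i ends by (auto simp: c_def)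
    also have "c (r 0) = p i"
      using partition_mono[of n p 0 i] p i ends by (auto simp: c_def)
    finally show ?thesis .
  qed
  have "simple_ito_integral B L r (\<lambda>j. simple_eval n p \<xi> (r (Suc j))) \<omega>
    = (\<Sum>j<L. \<Sum>i<n. \<xi> i \<omega> *
        (indicator {p i<..p (Suc i)} (r (Suc j)) * (B (r (Suc j)) \<omega> - B (r j) \<omega>)))"
    by (simp only: simple_ito_integral_def simple_eval_def sum_distrib_right mult.assoc)
  also have "\<dots> = (\<Sum>i<n. \<xi> i \<omega> * (\<Sum>j<L. indicator {p i<..p (Suc i)} (r (Suc j))
      * (B (r (Suc j)) \<omega> - B (r j) \<omega>)))"
    by (subst sum.swap) (simp only: sum_distrib_left)
  also have "\<dots> = simple_ito_integral B n p \<xi> \<omega>"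
    unfolding simple_ito_integral_def by (intro sum.cong refl) (simp only: telescope lessThan_iff)
  finally show ?thesis .
qed

text \<open>At each time at most one summand is nonzero, so \<open>h\<close> acts on the
  coefficients; \<open>h 0 = 0\<close> takes care of times outside the partition. With
  \<open>h\<close> the square it turns the energy into the time integral of another step
  function.\<close>

lemma simple_eval_comp:
  assumes "\<forall>i<n. p i \<le> p (Suc i)" "h 0 = 0"
  shows "h (simple_eval n p \<xi> s \<omega>) = simple_eval n p (\<lambda>i \<omega>. h (\<xi> i \<omega>)) s \<omega>"
proof (rule simple_eval_eqI[OF assms(1), symmetric])
  assume "s \<notin> {p 0<..p n}"
  then show "h (simple_eval n p \<xi> s \<omega>) = 0"
    using simple_eval_outside[OF assms(1)] assms(2) by metis
next
  fix i assume "i < n" "p i < s" "s \<le> p (Suc i)"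
  then show "h (simple_eval n p \<xi> s \<omega>) = h (\<xi> i \<omega>)"
    using simple_eval_cell[OF assms(1)] by metis
qed

lemma measurable_simple_eval_time [measurable]:
  "(\<lambda>s. simple_eval n p \<xi> s \<omega>) \<in> borel_measurable borel"
  unfolding simple_eval_def
  by (intro borel_measurable_sum borel_measurable_times borel_measurable_const
      borel_measurable_indicator) auto

lemma set_integral_simple_eval:
  assumes p: "\<forall>i<n. p i \<le> p (Suc i)"
  shows "set_integrable lborel {p 0..p n} (\<lambda>s. simple_eval n p \<xi> s \<omega>)"
    and "(LBINT s:{p 0..p n}. simple_eval n p \<xi> s \<omega>) = (\<Sum>i<n. \<xi> i \<omega> * (p (Suc i) - p i))"
proof -
  have eq: "indicator {p 0..p n} s *\<^sub>R simple_eval n p \<xi> s \<omega>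
    = (\<Sum>i<n. \<xi> i \<omega> * indicator {p i<..p (Suc i)} s)" for s
  proof (cases "s \<in> {p 0<..p n}")
    case True
    then show ?thesis by (simp add: simple_eval_def)
  next
    case False
    then show ?thesis using simple_eval_outside[of n p s \<xi> \<omega>, OF p] by (simp add: simple_eval_def)
  qed
  have int: "integrable lborel (\<lambda>s. \<xi> i \<omega> * indicator {p i<..p (Suc i)} s)" if "i \<in> {..<n}" for i
    using p that by (intro integrable_mult_right integrable_real_indicator) auto
  show "set_integrable lborel {p 0..p n} (\<lambda>s. simple_eval n p \<xi> s \<omega>)"
    unfolding set_integrable_def eq by (intro Bochner_Integration.integrable_sum int)
  have "(LBINT s:{p 0..p n}. simple_eval n p \<xi> s \<omega>)
    = (\<Sum>i<n. \<integral>s. \<xi> i \<omega> * indicator {p i<..p (Suc i)} s \<partial>lborel)"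
    unfolding set_lebesgue_integral_def eq by (intro Bochner_Integration.integral_sum int)
  also have "\<dots> = (\<Sum>i<n. \<xi> i \<omega> * (p (Suc i) - p i))"
    using p by (intro sum.cong) auto
  finally show "(LBINT s:{p 0..p n}. simple_eval n p \<xi> s \<omega>) = (\<Sum>i<n. \<xi> i \<omega> * (p (Suc i) - p i))" .
qed

text \<open>Partial sums of nonnegative terms stay above \<delta> once they have passed it. Hence
  the terms that are kept form an initial segment, and their total is 0 or an admissible partial
  sum.\<close>

lemma truncated_sum_le:
  fixes v :: "nat \<Rightarrow> real"
  assumes "\<And>i. i < n \<Longrightarrow> 0 \<le> v i" "0 \<le> \<delta>"
  shows "(\<Sum>i<n. if (\<Sum>j\<le>i. v j) \<le> \<delta> then v i else 0) \<le> \<delta>"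
  using assms
proof (induction n)
  case (Suc n)
  show ?case
  proof (cases "(\<Sum>j\<le>n. v j) \<le> \<delta>")
    case True
    have "(\<Sum>i<Suc n. if (\<Sum>j\<le>i. v j) \<le> \<delta> then v i else 0) \<le> (\<Sum>i<Suc n. v i)"
      using Suc.prems by (intro sum_mono) auto
    then show ?thesis using True by (simp add: lessThan_Suc_atMost)
  qed (use Suc in simp)
qed simp

section \<open>Independence of increments and the isometry for simple processes\<close>

context brownian_motion
begin

lemma measurable_F_mono:
  assumes "f \<in> borel_measurable (F s)" "s \<le> t"
  shows "f \<in> borel_measurable (F t)"
  by (rule measurable_from_subalg[OF _ assms(1)])
    (simp add: subalgebra_def space_F sets_F_mono[OF assms(2)])

lemma measurable_F:
  assumes "f \<in> borel_measurable (F s)"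
  shows "f \<in> borel_measurable M"
  by (rule measurable_from_subalg[OF _ assms]) (simp add: subalgebra_def space_F sets_F_subset)

lemma measurable_B: "0 \<le> t \<Longrightarrow> B t \<in> borel_measurable M"
  by (rule measurable_F[OF adapted])

text \<open>Preimages of Borel sets under the increment form a family closed under intersection, so
  the assumed independence of events extends to the generated sigma-algebras; the one generated by
  \<open>Y\<close> is contained in that of \<open>F s\<close>.\<close>

lemma indep_var_increment:
  assumes st: "0 \<le> s" "s < t" and Y: "Y \<in> borel_measurable (F s)"
  shows "indep_var borel Y borel (\<lambda>\<omega>. B t \<omega> - B s \<omega>)"
proof -
  let ?D = "\<lambda>\<omega>. B t \<omega> - B s \<omega>"
  let ?V = "{?D -` A \<inter> space M | A. A \<in> sets borel}"
  have "Int_stable ?V"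
  proof (rule Int_stableI)
    fix a b assume "a \<in> ?V" "b \<in> ?V"
    then obtain A A' where "A \<in> sets borel" "A' \<in> sets borel"
      "a = ?D -` A \<inter> space M" "b = ?D -` A' \<inter> space M" by auto
    then show "a \<inter> b \<in> ?V" by (intro CollectI exI[of _ "A \<inter> A'"]) auto
  qed
  then have 1: "indep_set (sigma_sets (space M) (sets (F s))) (sigma_sets (space M) ?V)"
    by (intro indep_set_sigma_sets indep_increments st sets.Int_stable)
  have "sigma_sets (space M) {Y -` A \<inter> space M | A. A \<in> sets borel}
      \<subseteq> sigma_sets (space M) (sets (F s))"
    using Y space_F[of s] by (intro sigma_sets_mono') (auto dest: measurable_sets)
  with 1 have "indep_set (sigma_sets (space M) {Y -` A \<inter> space M | A. A \<in> sets borel})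
      (sigma_sets (space M) ?V)"
    unfolding indep_sets2_eq by blast
  then show ?thesis
    unfolding indep_var_eq using measurable_F[OF Y] measurable_B[of s] measurable_B[of t] st by auto
qed

lemma increment_moments:
  assumes st: "0 \<le> s" "s < t"
  shows "integrable M (\<lambda>\<omega>. B t \<omega> - B s \<omega>)" "expectation (\<lambda>\<omega>. B t \<omega> - B s \<omega>) = 0"
    and "integrable M (\<lambda>\<omega>. (B t \<omega> - B s \<omega>)\<^sup>2)" "expectation (\<lambda>\<omega>. (B t \<omega> - B s \<omega>)\<^sup>2) = t - s"
proof -
  let ?\<sigma> = "sqrt (t - s)"
  have pos: "0 < ?\<sigma>" using st by simp
  note d = normal_increments[OF st]
  show E: "expectation (\<lambda>\<omega>. B t \<omega> - B s \<omega>) = 0"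
    by (rule normal_distributed_expectation[OF pos d])
  show "expectation (\<lambda>\<omega>. (B t \<omega> - B s \<omega>)\<^sup>2) = t - s"
    using normal_distributed_variance[OF pos d] E st by simp
  show "integrable M (\<lambda>\<omega>. B t \<omega> - B s \<omega>)"
    using distributed_integrable[OF d, of "\<lambda>x. x"] integrable_normal_moment_nz_1[OF pos, of 0] by auto
  show "integrable M (\<lambda>\<omega>. (B t \<omega> - B s \<omega>)\<^sup>2)"
    using distributed_integrable[OF d, of "\<lambda>x. x\<^sup>2"] integrable_normal_moment[OF pos, of 0 2] by auto
qed

text \<open>Since \<open>Y\<close> is known at the left end point, independence factors both
  expectations. The case \<open>s = t\<close> is treated apart: the increment is 0 and has no normal
  density.\<close>

lemma expectation_mult_increment:
  assumes st: "0 \<le> s" "s \<le> t" and Y: "Y \<in> borel_measurable (F s)" "integrable M Y"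
  shows "integrable M (\<lambda>\<omega>. Y \<omega> * (B t \<omega> - B s \<omega>))"
    and "expectation (\<lambda>\<omega>. Y \<omega> * (B t \<omega> - B s \<omega>)) = 0"
    and "integrable M (\<lambda>\<omega>. Y \<omega> * (B t \<omega> - B s \<omega>)\<^sup>2)"
    and "expectation (\<lambda>\<omega>. Y \<omega> * (B t \<omega> - B s \<omega>)\<^sup>2) = expectation Y * (t - s)"
proof -
  have "integrable M (\<lambda>\<omega>. Y \<omega> * (B t \<omega> - B s \<omega>)) \<and>
    expectation (\<lambda>\<omega>. Y \<omega> * (B t \<omega> - B s \<omega>)) = 0 \<and>
    integrable M (\<lambda>\<omega>. Y \<omega> * (B t \<omega> - B s \<omega>)\<^sup>2) \<and>
    expectation (\<lambda>\<omega>. Y \<omega> * (B t \<omega> - B s \<omega>)\<^sup>2) = expectation Y * (t - s)"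
  proof (cases "s = t")
    case False
    with st have st': "0 \<le> s" "s < t" by auto
    note m = increment_moments[OF st']
    note i1 = indep_var_increment[OF st' Y(1)]
    have i2: "indep_var borel Y borel (\<lambda>\<omega>. (B t \<omega> - B s \<omega>)\<^sup>2)"
      using indep_var_compose[OF i1, of "\<lambda>x. x" borel "\<lambda>x. x\<^sup>2" borel] by (simp add: o_def)
    show ?thesis
      using indep_var_integrable[OF i1 Y(2) m(1)] indep_var_lebesgue_integral[OF i1 Y(2) m(1)]
        indep_var_integrable[OF i2 Y(2) m(3)] indep_var_lebesgue_integral[OF i2 Y(2) m(3)] m(2,4)
      by simp
  qed simp
  then show "integrable M (\<lambda>\<omega>. Y \<omega> * (B t \<omega> - B s \<omega>))"
    and "expectation (\<lambda>\<omega>. Y \<omega> * (B t \<omega> - B s \<omega>)) = 0"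
    and "integrable M (\<lambda>\<omega>. Y \<omega> * (B t \<omega> - B s \<omega>)\<^sup>2)"
    and "expectation (\<lambda>\<omega>. Y \<omega> * (B t \<omega> - B s \<omega>)\<^sup>2) = expectation Y * (t - s)" by auto
qed

lemma simple_processD:
  assumes "simple_process F t n p \<xi>"
  shows "p 0 = 0" "p n = t" "\<forall>i<n. p i \<le> p (Suc i)"
    and "\<And>i. i < n \<Longrightarrow> \<xi> i \<in> borel_measurable (F (p i))"
    and "\<And>i. i < n \<Longrightarrow> \<xi> i \<in> borel_measurable M"
    and "\<And>i. i \<le> n \<Longrightarrow> 0 \<le> p i"
proof -
  show p: "p 0 = 0" "p n = t" "\<forall>i<n. p i \<le> p (Suc i)"
    using assms by (auto simp: simple_process_def)
  show *: "\<xi> i \<in> borel_measurable (F (p i))" if "i < n" for i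
    using assms that by (auto simp: simple_process_def)
  show "\<xi> i \<in> borel_measurable M" if "i < n" for i
    using *[OF that] by (rule measurable_F)
  show "0 \<le> p i" if "i \<le> n" for i
    using partition_mono[OF p(3), of 0 i] p(1) that by simp
qed

lemma simple_process_bounded:
  assumes "simple_process F t n p \<xi>" "i < n"
  obtains C where "0 \<le> C" "\<And>\<omega>. \<omega> \<in> space M \<Longrightarrow> \<bar>\<xi> i \<omega>\<bar> \<le> C"
proof -
  from assms obtain C where C: "\<And>\<omega>. \<omega> \<in> space M \<Longrightarrow> \<bar>\<xi> i \<omega>\<bar> \<le> C"
    unfolding simple_process_def space_F by blast
  obtain \<omega> where "\<omega> \<in> space M" using not_empty by auto
  from C[OF this] have "0 \<le> C" by simp
  with C that show ?thesis by blast
qed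

lemma measurable_simple_ito_integral:
  assumes "simple_process F t n p \<xi>"
  shows "simple_ito_integral B n p \<xi> \<in> borel_measurable (F t)"
  unfolding simple_ito_integral_def
proof (intro borel_measurable_sum borel_measurable_times borel_measurable_diff)
  fix i assume i: "i \<in> {..<n}"
  note p = simple_processD[OF assms]
  have le: "0 \<le> p i" "p i \<le> p (Suc i)" "p (Suc i) \<le> t"
    using i p(2,3) p(6)[of i] partition_mono[of n p "Suc i" n, OF p(3)] by auto
  show "\<xi> i \<in> borel_measurable (F t)"
    using i le by (intro measurable_F_mono[OF p(4)]) auto
  show "B (p (Suc i)) \<in> borel_measurable (F t)" "B (p i) \<in> borel_measurable (F t)"
    using le by (intro measurable_F_mono[OF adapted]; simp)+
qed

lemma simple_process_butlast:
  "simple_process F t (Suc n) p \<xi> \<Longrightarrow> simple_process F (p n) n p \<xi>"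
  by (auto simp: simple_process_def)

text \<open>Induction on the number of cells. In the square of
  \<open>J + \<xi> n * (increment)\<close> the cross term has mean 0, because its factor
  \<open>2 * J * \<xi> n\<close> is known when the last cell begins. The end point \<open>t\<close>
  varies in the induction since dropping the last cell moves it to \<open>p n\<close>.\<close>

lemma simple_ito_isometry:
  assumes "simple_process F t n p \<xi>"
  shows "integrable M (\<lambda>\<omega>. (simple_ito_integral B n p \<xi> \<omega>)\<^sup>2)"
    and "expectation (simple_ito_integral B n p \<xi>) = 0"
    and "expectation (\<lambda>\<omega>. (simple_ito_integral B n p \<xi> \<omega>)\<^sup>2)
      = (\<Sum>i<n. expectation (\<lambda>\<omega>. (\<xi> i \<omega>)\<^sup>2) * (p (Suc i) - p i))"
proof -
  have "integrable M (\<lambda>\<omega>. (simple_ito_integral B n p \<xi> \<omega>)\<^sup>2) \<and>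
    expectation (simple_ito_integral B n p \<xi>) = 0 \<and>
    expectation (\<lambda>\<omega>. (simple_ito_integral B n p \<xi> \<omega>)\<^sup>2)
      = (\<Sum>i<n. expectation (\<lambda>\<omega>. (\<xi> i \<omega>)\<^sup>2) * (p (Suc i) - p i))"
    using assms
  proof (induction n arbitrary: t)
    case (Suc n)
    let ?J = "simple_ito_integral B n p \<xi>" and ?s = "p n" and ?t = "p (Suc n)"
    note sp = simple_process_butlast[OF Suc.prems]
    note IH = Suc.IH[OF sp]
    have st: "0 \<le> ?s" "?s \<le> ?t" and \<xi>F: "\<xi> n \<in> borel_measurable (F ?s)"
      using simple_processD[OF Suc.prems] by auto
    note JF = measurable_simple_ito_integral[OF sp]
    note [measurable] = measurable_F[OF \<xi>F] measurable_F[OF JF]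
    obtain C where C: "0 \<le> C" "\<And>\<omega>. \<omega> \<in> space M \<Longrightarrow> \<bar>\<xi> n \<omega>\<bar> \<le> C"
      using simple_process_bounded[OF Suc.prems, of n] by blast
    have J: "integrable M ?J"
      using IH by (rule integrable_square_imp_integrable[rotated, OF conjunct1]) simp
    have i1: "integrable M (\<xi> n)"
      by (rule integrable_const_bound[of _ C]) (auto simp: C)
    have i2: "integrable M (\<lambda>\<omega>. (\<xi> n \<omega>)\<^sup>2)"
      by (rule integrable_const_bound[of _ "C\<^sup>2"]) (auto simp: C power2_le_iff_abs_le)
    \<comment> \<open>Boundedness of the coefficients is used here: \<open>J\<close> is integrable,
      and the product with a bounded \<open>\<xi> n\<close> remains so.\<close>
    have i3: "integrable M (\<lambda>\<omega>. 2 * ?J \<omega> * \<xi> n \<omega>)"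
    proof (rule Bochner_Integration.integrable_bound)
      show "integrable M (\<lambda>\<omega>. 2 * C * ?J \<omega>)" using J by simp
      show "AE \<omega> in M. norm (2 * ?J \<omega> * \<xi> n \<omega>) \<le> norm (2 * C * ?J \<omega>)"
        using C by (intro AE_I2) (auto simp: abs_mult mult.commute[of _ C] mult.commute[of _ "\<bar>\<xi> n _\<bar>"]
            intro!: mult_right_mono)
    qed simp
    have F1: "(\<lambda>\<omega>. (\<xi> n \<omega>)\<^sup>2) \<in> borel_measurable (F ?s)" using \<xi>F by simp
    have F2: "(\<lambda>\<omega>. 2 * ?J \<omega> * \<xi> n \<omega>) \<in> borel_measurable (F ?s)" using \<xi>F JF by simp
    note m1 = expectation_mult_increment[OF st \<xi>F i1]
    note m2 = expectation_mult_increment[OF st F1 i2]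
    note m3 = expectation_mult_increment[OF st F2 i3]
    have eq: "simple_ito_integral B (Suc n) p \<xi> = (\<lambda>\<omega>. ?J \<omega> + \<xi> n \<omega> * (B ?t \<omega> - B ?s \<omega>))"
      by (simp add: simple_ito_integral_def fun_eq_iff)
    have eq2: "(simple_ito_integral B (Suc n) p \<xi> \<omega>)\<^sup>2 = (?J \<omega>)\<^sup>2
      + 2 * ?J \<omega> * \<xi> n \<omega> * (B ?t \<omega> - B ?s \<omega>) + (\<xi> n \<omega>)\<^sup>2 * (B ?t \<omega> - B ?s \<omega>)\<^sup>2" for \<omega>
      unfolding eq by (simp add: power2_sum power_mult_distrib)
    show ?case unfolding eq2 unfolding eq using IH J m1 m2 m3 by simp
  qed (simp add: simple_ito_integral_def[abs_def])
  then show "integrable M (\<lambda>\<omega>. (simple_ito_integral B n p \<xi> \<omega>)\<^sup>2)"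
    and "expectation (simple_ito_integral B n p \<xi>) = 0"
    and "expectation (\<lambda>\<omega>. (simple_ito_integral B n p \<xi> \<omega>)\<^sup>2)
      = (\<Sum>i<n. expectation (\<lambda>\<omega>. (\<xi> i \<omega>)\<^sup>2) * (p (Suc i) - p i))" by auto
qed

text \<open>Stopping the integrand as soon as its accumulated energy exceeds \<open>\<delta>\<close> makes the isometry
  applicable and changes the integral only where the total energy exceeds \<open>\<delta>\<close>.\<close>

lemma prob_simple_ito_integral_le:
  assumes sp: "simple_process F t n p \<xi>" and \<epsilon>: "0 < \<epsilon>" and \<delta>: "0 \<le> \<delta>"
  shows "prob {\<omega> \<in> space M. \<epsilon> < \<bar>simple_ito_integral B n p \<xi> \<omega>\<bar>}
    \<le> prob {\<omega> \<in> space M. \<delta> < (\<Sum>i<n. (\<xi> i \<omega>)\<^sup>2 * (p (Suc i) - p i))} + \<delta> / \<epsilon>\<^sup>2"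
proof -
  note p = simple_processD[OF sp]
  define v where "v i \<omega> = (\<xi> i \<omega>)\<^sup>2 * (p (Suc i) - p i)" for i \<omega>
  \<comment> \<open>The test for the coefficient \<open>i\<close> includes its own energy
    \<open>v i\<close>. This is still known at time \<open>p i\<close>, as the length of the cell is
    deterministic, so \<open>\<eta>\<close> is adapted while its total energy never exceeds
    \<delta>.\<close>
  define \<eta> where "\<eta> i \<omega> = (if (\<Sum>j\<le>i. v j \<omega>) \<le> \<delta> then \<xi> i \<omega> else 0)" for i \<omega>
  have v_nonneg: "0 \<le> v i \<omega>" if "i < n" for i \<omega>
    using p(3) that by (simp add: v_def)
  have spe: "simple_process F t n p \<eta>"
    unfolding simple_process_def
  proof (intro conjI allI impI)
    fix i assume i: "i < n"
    have [measurable]: "\<xi> j \<in> borel_measurable (F (p i))" if "j \<le> i" for j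
      using i that by (intro measurable_F_mono[OF p(4)] partition_mono[OF p(3)]) auto
    have [measurable]: "(\<lambda>\<omega>. \<Sum>j\<le>i. v j \<omega>) \<in> borel_measurable (F (p i))"
      unfolding v_def by (intro borel_measurable_sum borel_measurable_times borel_measurable_power) auto
    show "\<eta> i \<in> borel_measurable (F (p i))"
      unfolding \<eta>_def by measurable
    obtain C where "0 \<le> C" "\<And>\<omega>. \<omega> \<in> space M \<Longrightarrow> \<bar>\<xi> i \<omega>\<bar> \<le> C"
      using simple_process_bounded[OF sp i] by blast
    then show "\<exists>C. \<forall>\<omega>\<in>space (F (p i)). \<bar>\<eta> i \<omega>\<bar> \<le> C"
      by (intro exI[of _ C]) (auto simp: \<eta>_def space_F)
  qed (use p in auto)
  note [measurable] = p(5) simple_processD(5)[OF spe]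
  let ?J = "simple_ito_integral B n p \<xi>" and ?J' = "simple_ito_integral B n p \<eta>"
  have [measurable]: "?J \<in> borel_measurable M" "?J' \<in> borel_measurable M"
    by (rule measurable_F measurable_simple_ito_integral sp spe)+
  have V[measurable]: "(\<lambda>\<omega>. \<Sum>i<n. v i \<omega>) \<in> borel_measurable M"
    unfolding v_def by (intro borel_measurable_sum borel_measurable_times borel_measurable_power) auto
  have int: "integrable M (\<lambda>\<omega>. (\<eta> i \<omega>)\<^sup>2)" if i: "i < n" for i
  proof -
    obtain C where C: "0 \<le> C" "\<And>\<omega>. \<omega> \<in> space M \<Longrightarrow> \<bar>\<eta> i \<omega>\<bar> \<le> C"
      using simple_process_bounded[OF spe i] by blast
    show ?thesis
      using i by (intro integrable_const_bound[of _ "C\<^sup>2"])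
        (auto simp: C power2_le_iff_abs_le)
  qed
  have "expectation (\<lambda>\<omega>. (?J' \<omega>)\<^sup>2) = expectation (\<lambda>\<omega>. \<Sum>i<n. (\<eta> i \<omega>)\<^sup>2 * (p (Suc i) - p i))"
    unfolding simple_ito_isometry(3)[OF spe] using int
    by (subst Bochner_Integration.integral_sum) auto
  also have "\<dots> \<le> expectation (\<lambda>\<omega>. \<delta>)"
  proof (rule integral_mono)
    fix \<omega>
    have "(\<eta> i \<omega>)\<^sup>2 * (p (Suc i) - p i) = (if (\<Sum>j\<le>i. v j \<omega>) \<le> \<delta> then v i \<omega> else 0)" for i
      by (simp add: \<eta>_def v_def)
    then show "(\<Sum>i<n. (\<eta> i \<omega>)\<^sup>2 * (p (Suc i) - p i)) \<le> \<delta>"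
      using truncated_sum_le[of n "\<lambda>i. v i \<omega>" \<delta>] v_nonneg \<delta> by simp
  qed (use int in auto)
  finally have EJ: "expectation (\<lambda>\<omega>. (?J' \<omega>)\<^sup>2) \<le> \<delta>" by (simp add: prob_space)
  have "prob {\<omega> \<in> space M. \<epsilon> < \<bar>?J' \<omega>\<bar>} = expectation (indicator {\<omega> \<in> space M. \<epsilon> < \<bar>?J' \<omega>\<bar>})"
    by simp
  \<comment> \<open>Chebyshev's inequality for the truncated integral.\<close>
  also have "\<dots> \<le> expectation (\<lambda>\<omega>. (?J' \<omega>)\<^sup>2 / \<epsilon>\<^sup>2)"
  proof (rule integral_mono)
    show "indicator {\<omega> \<in> space M. \<epsilon> < \<bar>?J' \<omega>\<bar>} \<omega> \<le> (?J' \<omega>)\<^sup>2 / \<epsilon>\<^sup>2" for \<omega>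
      using \<epsilon> abs_le_square_iff[of \<epsilon> "?J' \<omega>"] by (auto simp: indicator_def field_simps)
  qed (use simple_ito_isometry(1)[OF spe] in auto)
  also have "\<dots> \<le> \<delta> / \<epsilon>\<^sup>2"
    using EJ by (simp add: divide_right_mono)
  finally have tail: "prob {\<omega> \<in> space M. \<epsilon> < \<bar>?J' \<omega>\<bar>} \<le> \<delta> / \<epsilon>\<^sup>2" .
  have eq: "?J \<omega> = ?J' \<omega>" if "(\<Sum>i<n. v i \<omega>) \<le> \<delta>" for \<omega>
  proof -
    have "\<eta> i \<omega> = \<xi> i \<omega>" if "i < n" for i
    proof -
      have "(\<Sum>j\<le>i. v j \<omega>) \<le> (\<Sum>j<n. v j \<omega>)"
        using that v_nonneg by (intro sum_mono2) auto
      then show ?thesis using \<open>(\<Sum>i<n. v i \<omega>) \<le> \<delta>\<close> by (simp add: \<eta>_def)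
    qed
    then show ?thesis by (simp add: simple_ito_integral_def)
  qed
  have "prob {\<omega> \<in> space M. \<epsilon> < \<bar>?J \<omega>\<bar>} \<le> prob {\<omega> \<in> space M. \<delta> < (\<Sum>i<n. v i \<omega>)}
      + prob {\<omega> \<in> space M. \<epsilon> < \<bar>?J' \<omega>\<bar>}"
  proof (rule prob_union_le)
    show "AE \<omega> in M. \<epsilon> < \<bar>?J \<omega>\<bar> \<longrightarrow> \<delta> < (\<Sum>i<n. v i \<omega>) \<or> \<epsilon> < \<bar>?J' \<omega>\<bar>"
      using eq by (intro AE_I2) (metis not_le)
  qed measurable
  with tail show ?thesis unfolding v_def by linarith
qed

section \<open>Common refinements and independence of the approximating sequence\<close>

lemma simple_process_refine:
  assumes sp: "simple_process F t n p \<xi>" and r: "\<forall>j<L. r j \<le> r (Suc j)"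
    and ends: "r 0 = 0" "r L = t" and sub: "p ` {..n} \<subseteq> r ` {..L}"
  shows "simple_process F t L r (\<lambda>j. simple_eval n p \<xi> (r (Suc j)))"
  unfolding simple_process_def
proof (intro conjI allI impI)
  note p = simple_processD[OF sp]
  fix j assume j: "j < L"
  show "simple_eval n p \<xi> (r (Suc j)) \<in> borel_measurable (F (r j))"
    unfolding simple_eval_def
  proof (rule borel_measurable_sum)
    fix i assume i: "i \<in> {..<n}"
    show "(\<lambda>\<omega>. \<xi> i \<omega> * indicator {p i<..p (Suc i)} (r (Suc j))) \<in> borel_measurable (F (r j))"
    \<comment> \<open>Although the coefficient is sampled at \<open>r (Suc j)\<close>, it is known
      at \<open>r j\<close>: a coarse point below \<open>r (Suc j)\<close> cannot lie inside the
      fine cell, and otherwise the indicator is 0.\<close>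
    proof (cases "p i < r (Suc j)")
      case True
      have "p i \<in> r ` {..L}" using sub i by auto
      with partition_gap[OF r this j] True have "p i \<le> r j" by auto
      then have "\<xi> i \<in> borel_measurable (F (r j))"
        using i by (intro measurable_F_mono[OF p(4)]) auto
      then show ?thesis by measurable
    qed simp
  qed
  have "\<forall>i\<in>{..<n}. \<exists>C. \<forall>\<omega>\<in>space M. \<bar>\<xi> i \<omega>\<bar> \<le> C"
    using sp by (auto simp: simple_process_def space_F)
  then obtain C where C: "\<And>i \<omega>. i < n \<Longrightarrow> \<omega> \<in> space M \<Longrightarrow> \<bar>\<xi> i \<omega>\<bar> \<le> C i"
    by (auto dest!: bchoice)
  have "\<bar>simple_eval n p \<xi> (r (Suc j)) \<omega>\<bar> \<le> (\<Sum>i<n. C i)" if "\<omega> \<in> space M" for \<omega>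
    unfolding simple_eval_def
  proof (intro order_trans[OF sum_abs] sum_mono)
    fix i assume "i \<in> {..<n}"
    then show "\<bar>\<xi> i \<omega> * indicator {p i<..p (Suc i)} (r (Suc j))\<bar> \<le> C i"
      using C[of i \<omega>] that by (auto simp: indicator_def)
  qed
  then show "\<exists>C. \<forall>\<omega>\<in>space (F (r j)). \<bar>simple_eval n p \<xi> (r (Suc j)) \<omega>\<bar> \<le> C"
    unfolding space_F by blast
qed (use r ends in auto)

text \<open>On the union of both partitions the difference can be taken coefficient by coefficient.
  This makes estimates for one simple integral available for the difference of two.\<close>

lemma simple_process_diff:
  assumes sp1: "simple_process F t n p \<xi>" and sp2: "simple_process F t m q \<eta>"
  obtains L r \<zeta> where "simple_process F t L r \<zeta>"
    and "\<And>s \<omega>. simple_eval L r \<zeta> s \<omega> = simple_eval n p \<xi> s \<omega> - simple_eval m q \<eta> s \<omega>"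
    and "\<And>\<omega>. simple_ito_integral B L r \<zeta> \<omega>
      = simple_ito_integral B n p \<xi> \<omega> - simple_ito_integral B m q \<eta> \<omega>"
proof -
  note p = simple_processD[OF sp1] and q = simple_processD[OF sp2]
  obtain L r where r: "r ` {..L} = p ` {..n} \<union> q ` {..m}" "\<forall>j<L. r j \<le> r (Suc j)"
    by (rule finite_set_partition[of "p ` {..n} \<union> q ` {..m}"]) auto
  have range: "0 \<le> x \<and> x \<le> t" if "x \<in> p ` {..n} \<union> q ` {..m}" for x
    using that partition_mono[OF p(3), of _ n] partition_mono[OF q(3), of _ m] p(2,6) q(2,6) by auto
  have "0 \<in> r ` {..L}" "t \<in> r ` {..L}"
    unfolding r(1) using p(1,2) by (metis UnI1 atMost_iff image_eqI le0 order_refl)+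
  then obtain a b where "a \<le> L" "r a = 0" "b \<le> L" "r b = t" by fastforce
  moreover have "r 0 \<in> p ` {..n} \<union> q ` {..m}" "r L \<in> p ` {..n} \<union> q ` {..m}"
    unfolding r(1)[symmetric] by auto
  \<comment> \<open>All points lie in \<open>[0, t]\<close> and both ends occur among them, so
    monotonicity puts them in the extreme positions.\<close>
  ultimately have ends: "r 0 = 0" "r L = t"
    using range[of "r 0"] range[of "r L"] partition_mono[OF r(2), of 0 a] partition_mono[OF r(2), of b L]
    by auto
  define \<xi>' where "\<xi>' j = simple_eval n p \<xi> (r (Suc j))" for j
  define \<eta>' where "\<eta>' j = simple_eval m q \<eta> (r (Suc j))" for j
  define \<zeta> where "\<zeta> j \<omega> = \<xi>' j \<omega> - \<eta>' j \<omega>" for j \<omega>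
  have sp': "simple_process F t L r \<xi>'" "simple_process F t L r \<eta>'"
    unfolding \<xi>'_def \<eta>'_def using r ends sp1 sp2 by (auto intro!: simple_process_refine)
  show ?thesis
  proof
    show "simple_process F t L r \<zeta>"
      unfolding simple_process_def
    proof (intro conjI allI impI)
      fix j assume j: "j < L"
      show "\<zeta> j \<in> borel_measurable (F (r j))"
        unfolding \<zeta>_def using simple_processD(4)[OF sp'(1) j] simple_processD(4)[OF sp'(2) j] by simp
      obtain C where "\<And>\<omega>. \<omega> \<in> space M \<Longrightarrow> \<bar>\<xi>' j \<omega>\<bar> \<le> C"
        using simple_process_bounded[OF sp'(1) j] by blast
      moreover obtain D where "\<And>\<omega>. \<omega> \<in> space M \<Longrightarrow> \<bar>\<eta>' j \<omega>\<bar> \<le> D"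
        using simple_process_bounded[OF sp'(2) j] by blast
      ultimately have "\<bar>\<zeta> j \<omega>\<bar> \<le> C + D" if "\<omega> \<in> space M" for \<omega>
        using that unfolding \<zeta>_def by (smt (verit))
      then show "\<exists>C. \<forall>\<omega>\<in>space (F (r j)). \<bar>\<zeta> j \<omega>\<bar> \<le> C"
        unfolding space_F by blast
    qed (use r ends in auto)
    fix s \<omega>
    have "simple_eval L r \<zeta> s \<omega> = simple_eval L r \<xi>' s \<omega> - simple_eval L r \<eta>' s \<omega>"
      by (simp only: simple_eval_def \<zeta>_def left_diff_distrib sum_subtractf)
    then show "simple_eval L r \<zeta> s \<omega> = simple_eval n p \<xi> s \<omega> - simple_eval m q \<eta> s \<omega>"
      unfolding \<xi>'_def \<eta>'_def using p q r ends by (simp add: simple_eval_refine)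
    have "simple_ito_integral B L r \<zeta> \<omega> = simple_ito_integral B L r \<xi>' \<omega> - simple_ito_integral B L r \<eta>' \<omega>"
      by (simp only: simple_ito_integral_def \<zeta>_def left_diff_distrib sum_subtractf)
    then show "simple_ito_integral B L r \<zeta> \<omega>
      = simple_ito_integral B n p \<xi> \<omega> - simple_ito_integral B m q \<eta> \<omega>"
      unfolding \<xi>'_def \<eta>'_def using p q r ends by (simp add: simple_ito_integral_refine)
  qed
qed

lemma set_integral_simple_eval_square:
  assumes sp: "simple_process F t n p \<xi>"
  shows "set_integrable lborel {0..t} (\<lambda>s. (simple_eval n p \<xi> s \<omega>)\<^sup>2)"
    and "(LBINT s:{0..t}. (simple_eval n p \<xi> s \<omega>)\<^sup>2) = (\<Sum>i<n. (\<xi> i \<omega>)\<^sup>2 * (p (Suc i) - p i))"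
  using set_integral_simple_eval[of n p "\<lambda>i \<omega>. (\<xi> i \<omega>)\<^sup>2" \<omega>] simple_processD[OF sp]
    simple_eval_comp[of n p "\<lambda>x. x\<^sup>2" \<xi> _ \<omega>]
  by simp_all

lemma prob_simple_ito_integral_diff_le:
  assumes "simple_process F t n p \<xi>" "simple_process F t m q \<eta>" "0 < \<epsilon>" "0 \<le> \<delta>"
  shows "prob {\<omega> \<in> space M. \<epsilon> < \<bar>simple_ito_integral B n p \<xi> \<omega> - simple_ito_integral B m q \<eta> \<omega>\<bar>}
    \<le> prob {\<omega> \<in> space M. \<delta> < (LBINT s:{0..t}. (simple_eval n p \<xi> s \<omega> - simple_eval m q \<eta> s \<omega>)\<^sup>2)}
      + \<delta> / \<epsilon>\<^sup>2"
proof -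
  obtain L r \<zeta> where z: "simple_process F t L r \<zeta>"
    and *: "\<And>s \<omega>. simple_eval L r \<zeta> s \<omega> = simple_eval n p \<xi> s \<omega> - simple_eval m q \<eta> s \<omega>"
      "\<And>\<omega>. simple_ito_integral B L r \<zeta> \<omega> = simple_ito_integral B n p \<xi> \<omega> - simple_ito_integral B m q \<eta> \<omega>"
    using simple_process_diff[OF assms(1,2)] by metis
  show ?thesis
    using prob_simple_ito_integral_le[OF z assms(3,4)]
    unfolding set_integral_simple_eval_square(2)[OF z, symmetric] * .
qed

lemma measurable_simple_eval_joint:
  assumes "simple_process F t n p \<xi>"
  shows "(\<lambda>(\<omega>, s). simple_eval n p \<xi> s \<omega>) \<in> borel_measurable (M \<Otimes>\<^sub>M borel)"
  unfolding simple_eval_def split_beta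
proof (intro borel_measurable_sum borel_measurable_times)
  fix i assume "i \<in> {..<n}"
  then have "\<xi> i \<in> borel_measurable M" using simple_processD(5)[OF assms] by auto
  then show "(\<lambda>x. \<xi> i (fst x)) \<in> borel_measurable (M \<Otimes>\<^sub>M borel)" by measurable
  have "indicator {p i<..p (Suc i)} \<in> borel_measurable (borel :: real measure)" by measurable
  then show "(\<lambda>x. indicator {p i<..p (Suc i)} (snd x) :: real) \<in> borel_measurable (M \<Otimes>\<^sub>M borel)"
    by measurable
qed

lemma measurable_energy:
  fixes f :: "real \<Rightarrow> 'a \<Rightarrow> real"
  assumes [measurable]: "(\<lambda>(\<omega>, s). f s \<omega>) \<in> borel_measurable (M \<Otimes>\<^sub>M borel)"
  shows "(\<lambda>\<omega>. LBINT s:{0..t}. f s \<omega>) \<in> borel_measurable M"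
proof -
  have "(\<lambda>(\<omega>, s). indicator {0..t} s *\<^sub>R f s \<omega>) \<in> borel_measurable (M \<Otimes>\<^sub>M lborel)"
    by measurable
  then show ?thesis
    unfolding set_lebesgue_integral_def by (rule lborel.borel_measurable_lebesgue_integral)
qed

text \<open>By \<open>(a - b)\<^sup>2 \<le> 2 * a\<^sup>2 + 2 * b\<^sup>2\<close>, two sequences
  approximating \<open>H\<close> have differences whose energy tends to 0 in probability. Their
  integrals therefore approach each other in probability, and those of the sequence from the
  definition tend to \<open>I\<close>.\<close>

lemma has_ito_integral_limit:
  assumes ito: "has_ito_integral M F B t H I"
    and H[measurable]: "(\<lambda>(\<omega>, s). H s \<omega>) \<in> borel_measurable (M \<Otimes>\<^sub>M borel)"
    and sp: "\<And>k. simple_process F t (m k) (q k) (\<eta> k)"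
    and lim: "converges_in_prob M
      (\<lambda>k \<omega>. LBINT s:{0..t}. (simple_eval (m k) (q k) (\<eta> k) s \<omega> - H s \<omega>)\<^sup>2) (\<lambda>_. 0)"
  shows "converges_in_prob M (\<lambda>k. simple_ito_integral B (m k) (q k) (\<eta> k)) I"
proof -
  from ito obtain n p \<xi> where sp': "\<And>k. simple_process F t (n k) (p k) (\<xi> k)"
    and lim': "converges_in_prob M
      (\<lambda>k \<omega>. LBINT s:{0..t}. (simple_eval (n k) (p k) (\<xi> k) s \<omega> - H s \<omega>)\<^sup>2) (\<lambda>_. 0)"
    and limI: "converges_in_prob M (\<lambda>k. simple_ito_integral B (n k) (p k) (\<xi> k)) I"
    and [measurable]: "I \<in> borel_measurable M"
    and sq: "AE \<omega> in M. set_integrable lborel {0..t} (\<lambda>s. (H s \<omega>)\<^sup>2)"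
    unfolding has_ito_integral_def ito_integrand_def by blast
  define J where "J k = simple_ito_integral B (m k) (q k) (\<eta> k)" for k
  define J' where "J' k = simple_ito_integral B (n k) (p k) (\<xi> k)" for k
  define e where "e k = simple_eval (m k) (q k) (\<eta> k)" for k
  define e' where "e' k = simple_eval (n k) (p k) (\<xi> k)" for k
  define Q where "Q k \<omega> = (LBINT s:{0..t}. (e k s \<omega> - H s \<omega>)\<^sup>2)" for k \<omega>
  define Q' where "Q' k \<omega> = (LBINT s:{0..t}. (e' k s \<omega> - H s \<omega>)\<^sup>2)" for k \<omega>
  have [measurable]: "(\<lambda>(\<omega>, s). e k s \<omega>) \<in> borel_measurable (M \<Otimes>\<^sub>M borel)"
    "(\<lambda>(\<omega>, s). e' k s \<omega>) \<in> borel_measurable (M \<Otimes>\<^sub>M borel)" for k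
    unfolding e_def e'_def using measurable_simple_eval_joint sp sp' by blast+
  have [measurable]: "Q k \<in> borel_measurable M" "Q' k \<in> borel_measurable M" for k
    unfolding Q_def Q'_def by (rule measurable_energy; measurable)+
  have [measurable]: "J k \<in> borel_measurable M" "J' k \<in> borel_measurable M" for k
    unfolding J_def J'_def using measurable_F[OF measurable_simple_ito_integral] sp sp' by blast+
  have bound: "AE \<omega> in M. (LBINT s:{0..t}. (e k s \<omega> - e' k s \<omega>)\<^sup>2) \<le> 2 * Q k \<omega> + 2 * Q' k \<omega>" for k
    using sq AE_space
  proof eventually_elim
    case (elim \<omega>)
    have [measurable]: "(\<lambda>s. H s \<omega>) \<in> borel_measurable borel"
      using measurable_compose[OF measurable_Pair1'[OF elim(2)] H] by simp
    have diff: "set_integrable lborel {0..t} (\<lambda>s. (f s - g s)\<^sup>2)"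
      if [measurable]: "f \<in> borel_measurable borel" "g \<in> borel_measurable borel"
        and f: "set_integrable lborel {0..t} (\<lambda>s. (f s)\<^sup>2)"
        and g: "set_integrable lborel {0..t} (\<lambda>s. (g s)\<^sup>2)" for f g :: "real \<Rightarrow> real"
    proof (rule set_integrable_bound)
      show "set_integrable lborel {0..t} (\<lambda>s. 2 * (f s)\<^sup>2 + 2 * (g s)\<^sup>2)"
        using f g by (intro set_integral_add(1)) simp_all
      show "set_borel_measurable lborel {0..t} (\<lambda>s. (f s - g s)\<^sup>2)"
        unfolding set_borel_measurable_def by measurable
      have "(f s - g s)\<^sup>2 \<le> 2 * (f s)\<^sup>2 + 2 * (g s)\<^sup>2" for s
        using zero_le_power2[of "f s + g s"] by (simp add: power2_sum power2_diff)
      then show "AE s in lborel. s \<in> {0..t} \<longrightarrow> norm ((f s - g s)\<^sup>2) \<le> norm (2 * (f s)\<^sup>2 + 2 * (g s)\<^sup>2)"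
        by (auto intro!: AE_I2)
    qed
    have meas: "(\<lambda>s. e k s \<omega>) \<in> borel_measurable borel" "(\<lambda>s. e' k s \<omega>) \<in> borel_measurable borel"
      unfolding e_def e'_def by measurable
    note s1 = set_integral_simple_eval_square(1)[OF sp[of k], of \<omega>, folded e_def]
    note s2 = set_integral_simple_eval_square(1)[OF sp'[of k], of \<omega>, folded e'_def]
    \<comment> \<open>The comparison of integrals depends on this: a nonintegrable function would
      have integral 0 by convention, and then a small \<open>Q k\<close> would control
      nothing.\<close>
    have int: "set_integrable lborel {0..t} (\<lambda>s. (e k s \<omega> - H s \<omega>)\<^sup>2)"
      "set_integrable lborel {0..t} (\<lambda>s. (e' k s \<omega> - H s \<omega>)\<^sup>2)"
      "set_integrable lborel {0..t} (\<lambda>s. (e k s \<omega> - e' k s \<omega>)\<^sup>2)"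
      using s1 s2 elim(1) meas by (auto intro!: diff)
    have "(LBINT s:{0..t}. (e k s \<omega> - e' k s \<omega>)\<^sup>2)
      \<le> (LBINT s:{0..t}. 2 * (e k s \<omega> - H s \<omega>)\<^sup>2 + 2 * (e' k s \<omega> - H s \<omega>)\<^sup>2)"
    proof (rule set_integral_mono)
      fix s
      show "(e k s \<omega> - e' k s \<omega>)\<^sup>2 \<le> 2 * (e k s \<omega> - H s \<omega>)\<^sup>2 + 2 * (e' k s \<omega> - H s \<omega>)\<^sup>2"
        using zero_le_power2[of "(e k s \<omega> - H s \<omega>) + (e' k s \<omega> - H s \<omega>)"]
        by (simp add: power2_eq_square algebra_simps)
    qed (use int in \<open>auto intro!: set_integral_add(1)\<close>)
    also have "\<dots> = 2 * Q k \<omega> + 2 * Q' k \<omega>"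
      unfolding Q_def Q'_def using int by (subst set_integral_add(2)) simp_all
    finally show ?case .
  qed
  have diff: "(\<lambda>k. prob {\<omega> \<in> space M. \<epsilon> < \<bar>J k \<omega> - J' k \<omega>\<bar>}) \<longlonglongrightarrow> 0" if \<epsilon>: "0 < \<epsilon>" for \<epsilon>
  proof (rule LIMSEQ_I)
    fix c :: real assume c: "0 < c"
    \<comment> \<open>Makes the deterministic term \<open>\<delta> / \<epsilon>\<^sup>2\<close>
      equal to \<open>c / 2\<close>. If \<open>2 * Q k + 2 * Q' k\<close> exceeds \<delta>, one of
      the two energies exceeds \<open>\<delta> / 4\<close>, and each of these events is given
      probability below \<open>c / 4\<close>.\<close>
    define \<delta> where "\<delta> = c / 2 * \<epsilon>\<^sup>2"
    have \<delta>: "0 < \<delta>" "\<delta> / \<epsilon>\<^sup>2 = c / 2" using c \<epsilon> by (simp_all add: \<delta>_def)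
    have lims: "(\<lambda>k. prob {\<omega> \<in> space M. \<delta> / 4 < \<bar>Q k \<omega> - 0\<bar>}) \<longlonglongrightarrow> 0"
      "(\<lambda>k. prob {\<omega> \<in> space M. \<delta> / 4 < \<bar>Q' k \<omega> - 0\<bar>}) \<longlonglongrightarrow> 0"
      using lim[unfolded converges_in_prob_def, rule_format, of "\<delta> / 4"]
        lim'[unfolded converges_in_prob_def, rule_format, of "\<delta> / 4"] \<delta>
      unfolding Q_def Q'_def e_def e'_def by simp_all
    have "eventually (\<lambda>k. prob {\<omega> \<in> space M. \<delta> / 4 < \<bar>Q k \<omega> - 0\<bar>} < c / 4) sequentially"
      "eventually (\<lambda>k. prob {\<omega> \<in> space M. \<delta> / 4 < \<bar>Q' k \<omega> - 0\<bar>} < c / 4) sequentially"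
      using order_tendstoD(2)[OF lims(1), of "c / 4"] order_tendstoD(2)[OF lims(2), of "c / 4"] c by simp_all
    then have "eventually (\<lambda>k. norm (prob {\<omega> \<in> space M. \<epsilon> < \<bar>J k \<omega> - J' k \<omega>\<bar>} - 0) < c) sequentially"
    proof eventually_elim
      case (elim k)
      have "prob {\<omega> \<in> space M. \<epsilon> < \<bar>J k \<omega> - J' k \<omega>\<bar>}
        \<le> prob {\<omega> \<in> space M. \<delta> < (LBINT s:{0..t}. (e k s \<omega> - e' k s \<omega>)\<^sup>2)} + c / 2"
        unfolding J_def J'_def e_def e'_def \<delta>(2)[symmetric]
        using \<epsilon> \<delta> by (intro prob_simple_ito_integral_diff_le sp sp') auto
      also have "prob {\<omega> \<in> space M. \<delta> < (LBINT s:{0..t}. (e k s \<omega> - e' k s \<omega>)\<^sup>2)}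
        \<le> prob {\<omega> \<in> space M. \<delta> / 4 < \<bar>Q k \<omega> - 0\<bar>} + prob {\<omega> \<in> space M. \<delta> / 4 < \<bar>Q' k \<omega> - 0\<bar>}"
      proof (rule prob_union_le)
        show "AE \<omega> in M. \<delta> < (LBINT s:{0..t}. (e k s \<omega> - e' k s \<omega>)\<^sup>2) \<longrightarrow>
          \<delta> / 4 < \<bar>Q k \<omega> - 0\<bar> \<or> \<delta> / 4 < \<bar>Q' k \<omega> - 0\<bar>"
          using bound[of k] by eventually_elim linarith
      qed measurable
      finally show ?case using elim by simp
    qed
    then show "\<exists>n0. \<forall>n\<ge>n0. norm (prob {\<omega> \<in> space M. \<epsilon> < \<bar>J n \<omega> - J' n \<omega>\<bar>} - 0) < c"
      by (simp add: eventually_sequentially)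
  qed
  show ?thesis
    unfolding converges_in_prob_def J_def[symmetric]
  proof (intro allI impI)
    fix \<epsilon> :: real assume \<epsilon>: "0 < \<epsilon>"
    have le: "prob {\<omega> \<in> space M. \<epsilon> < \<bar>J k \<omega> - I \<omega>\<bar>}
      \<le> prob {\<omega> \<in> space M. \<epsilon> / 2 < \<bar>J k \<omega> - J' k \<omega>\<bar>} + prob {\<omega> \<in> space M. \<epsilon> / 2 < \<bar>J' k \<omega> - I \<omega>\<bar>}" for k
    proof (rule prob_union_le)
      show "AE \<omega> in M. \<epsilon> < \<bar>J k \<omega> - I \<omega>\<bar> \<longrightarrow>
        \<epsilon> / 2 < \<bar>J k \<omega> - J' k \<omega>\<bar> \<or> \<epsilon> / 2 < \<bar>J' k \<omega> - I \<omega>\<bar>"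
        by (intro AE_I2) linarith
    qed measurable
    have "(\<lambda>k. prob {\<omega> \<in> space M. \<epsilon> / 2 < \<bar>J' k \<omega> - I \<omega>\<bar>}) \<longlonglongrightarrow> 0"
      using limI[unfolded converges_in_prob_def, rule_format, of "\<epsilon> / 2"] \<epsilon> by (simp add: J'_def)
    from tendsto_add[OF diff[of "\<epsilon> / 2"] this] \<epsilon>
    have "(\<lambda>k. prob {\<omega> \<in> space M. \<epsilon> / 2 < \<bar>J k \<omega> - J' k \<omega>\<bar>}
        + prob {\<omega> \<in> space M. \<epsilon> / 2 < \<bar>J' k \<omega> - I \<omega>\<bar>}) \<longlonglongrightarrow> 0" by simp
    from tendsto_sandwich[OF _ _ tendsto_const this]
    show "(\<lambda>k. prob {\<omega> \<in> space M. \<epsilon> < \<bar>J k \<omega> - I \<omega>\<bar>}) \<longlonglongrightarrow> 0"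
      using le by (simp add: always_eventually)
  qed
qed

end

section \<open>Ito integrals of continuous adapted processes\<close>

text \<open>There are \<open>Suc k\<close> cells, so that the mesh \<open>t / real (Suc k)\<close>
  makes sense for every \<open>k\<close>.\<close>

definition grid :: "real \<Rightarrow> nat \<Rightarrow> nat \<Rightarrow> real" where
  "grid t k i = t * real i / real (Suc k)"

lemma grid_mono: "0 \<le> t \<Longrightarrow> i \<le> j \<Longrightarrow> grid t k i \<le> grid t k j"
  unfolding grid_def by (intro divide_right_mono mult_left_mono) auto

lemma grid_bounds:
  assumes "0 \<le> t" "i \<le> Suc k"
  shows "0 \<le> grid t k i" "grid t k i \<le> t"
  using grid_mono[OF assms(1), of 0 i k] grid_mono[OF assms, of k] by (simp_all add: grid_def)

lemma grid_ends: "grid t k 0 = 0" "grid t k (Suc k) = t"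
  by (simp_all add: grid_def)

text \<open>The mesh tends to 0, so the left end points of the cells containing \<open>s\<close>
  converge to \<open>s\<close>, strictly from below because cells are open on the left. This is the
  form in which left continuity is used.\<close>

lemma grid_left_points:
  assumes s: "0 < s" "s \<le> t"
  obtains i where "\<And>k. i k < Suc k" "\<And>k. s \<le> grid t k (Suc (i k))"
    and "(\<lambda>k. grid t k (i k)) \<longlonglongrightarrow> s" "\<And>k. 0 \<le> grid t k (i k)" "\<And>k. grid t k (i k) < s"
proof -
  have t: "0 \<le> t" using s by simp
  have "\<exists>i<Suc k. grid t k i < s \<and> s \<le> grid t k (Suc i)" for k
    using partition_cell[of "grid t k" s "Suc k"] s grid_ends[of t k] by metis
  then obtain i where i: "\<And>k. i k < Suc k" "\<And>k. grid t k (i k) < s" "\<And>k. s \<le> grid t k (Suc (i k))"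
    by metis
  have le: "s - t / real (Suc k) \<le> grid t k (i k)" for k
    using i(3)[of k] by (simp add: grid_def add_divide_distrib distrib_left)
  have lim: "(\<lambda>k. s - t / real (Suc k)) \<longlonglongrightarrow> s"
    using tendsto_diff[OF tendsto_const LIMSEQ_Suc[OF lim_const_over_n[of t]], of s] by simp
  have "(\<lambda>k. grid t k (i k)) \<longlonglongrightarrow> s"
    by (rule tendsto_sandwich[OF _ _ lim tendsto_const])
      (use le i(2) in \<open>auto intro!: always_eventually less_imp_le\<close>)
  moreover have "0 \<le> grid t k (i k)" for k
    using grid_bounds(1)[OF t, of "i k" k] i(1)[of k] by auto
  ultimately show ?thesis by (intro that[OF i(1) i(3) _ _ i(2)])
qed

lemma simple_eval_grid:
  assumes "0 \<le> t" "i < Suc k" "grid t k i < s" "s \<le> grid t k (Suc i)"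
  shows "simple_eval (Suc k) (grid t k) \<xi> s \<omega> = \<xi> i \<omega>"
  using assms(2-4) by (intro simple_eval_cell) (simp_all add: grid_mono[OF assms(1)])

text \<open>The sums are time integrals of left-point step functions, to which dominated convergence
  applies. The hypothesis is left continuity, since it will be used for the second moment of a
  stopped process.\<close>

lemma riemann_sum_limit:
  fixes g :: "real \<Rightarrow> real"
  assumes t: "0 \<le> t" and g[measurable]: "g \<in> borel_measurable borel"
    and bound: "\<And>s. s \<in> {0..t} \<Longrightarrow> \<bar>g s\<bar> \<le> C"
    and left: "\<And>s l. 0 < s \<Longrightarrow> s \<le> t \<Longrightarrow> l \<longlonglongrightarrow> s \<Longrightarrow> (\<And>k. 0 \<le> l k) \<Longrightarrow> (\<And>k. l k < s)
      \<Longrightarrow> (\<lambda>k :: nat. g (l k)) \<longlonglongrightarrow> g s"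
  shows "(\<lambda>k. \<Sum>i<Suc k. g (grid t k i) * (grid t k (Suc i) - grid t k i))
    \<longlonglongrightarrow> (LBINT s:{0..t}. g s)"
proof -
  \<comment> \<open>A one-point sample space turns the deterministic step function into an instance
    of \<open>simple_eval\<close>.\<close>
  define e where "e k s = simple_eval (Suc k) (grid t k) (\<lambda>i (_::unit). g (grid t k i)) s ()" for k s
  have [measurable]: "e k \<in> borel_measurable borel" for k unfolding e_def by measurable
  have mono: "\<forall>i<Suc k. grid t k i \<le> grid t k (Suc i)" for k using t by (auto intro: grid_mono)
  have "(\<Sum>i<Suc k. g (grid t k i) * (grid t k (Suc i) - grid t k i)) = (LBINT s:{0..t}. e k s)" for k
    using set_integral_simple_eval(2)[OF mono[of k], of "\<lambda>i _. g (grid t k i)" "()"]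
    unfolding e_def grid_ends by simp
  moreover have "(\<lambda>k. LBINT s:{0..t}. e k s) \<longlonglongrightarrow> (LBINT s:{0..t}. g s)"
    unfolding set_lebesgue_integral_def
  proof (rule integral_dominated_convergence)
    show "integrable lborel (\<lambda>s. indicator {0..t} s * C)"
      using t by (intro integrable_mult_left integrable_real_indicator) simp_all
    show "AE s in lborel. (\<lambda>k. indicator {0..t} s *\<^sub>R e k s) \<longlonglongrightarrow> indicator {0..t} s *\<^sub>R g s"
      using AE_lborel_singleton[of 0]
    proof eventually_elim
      case (elim s)
      show ?case
      proof (cases "s \<in> {0..t}")
        case True
        with elim have s: "0 < s" "s \<le> t" by auto
        obtain i where i: "\<And>k. i k < Suc k" "\<And>k. s \<le> grid t k (Suc (i k))"
          and l: "(\<lambda>k. grid t k (i k)) \<longlonglongrightarrow> s" "\<And>k. 0 \<le> grid t k (i k)" "\<And>k. grid t k (i k) < s"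
          using grid_left_points[OF s] by blast
        have "e k s = g (grid t k (i k))" for k
          unfolding e_def by (rule simple_eval_grid[OF _ i(1) l(3) i(2)]) (use t in simp)
        then show ?thesis using left[OF s l] by (simp add: tendsto_mult_left)
      qed simp
    qed
    fix k
    show "AE s in lborel. norm (indicator {0..t} s *\<^sub>R e k s) \<le> indicator {0..t} s * C"
      using AE_lborel_singleton[of 0]
    proof eventually_elim
      case (elim s)
      show ?case
      proof (cases "s \<in> {0..t}")
        case True
        with elim have s: "0 < s" "s \<le> t" by auto
        obtain i where i: "\<And>k. i k < Suc k" "\<And>k. s \<le> grid t k (Suc (i k))"
          and l: "(\<lambda>k. grid t k (i k)) \<longlonglongrightarrow> s" "\<And>k. 0 \<le> grid t k (i k)" "\<And>k. grid t k (i k) < s"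
          using grid_left_points[OF s] by blast
        have "e k s = g (grid t k (i k))"
          unfolding e_def by (rule simple_eval_grid[OF _ i(1) l(3) i(2)]) (use t in simp)
        then show ?thesis using bound[of "grid t k (i k)"] l(2,3)[of k] s True by simp
      qed simp
    qed
  qed measurable
  ultimately show ?thesis by simp
qed

text \<open>Joint measurability refers to all real times, so that the process can be composed with
  arbitrary measurable times; adaptedness and continuity refer to \<open>[0, T]\<close>.\<close>

locale continuous_adapted = brownian_motion M F B
  for M :: "'a measure" and F :: "real \<Rightarrow> 'a measure" and B :: "real \<Rightarrow> 'a \<Rightarrow> real" +
  fixes H :: "real \<Rightarrow> 'a \<Rightarrow> real" and T :: real
  assumes H_joint: "(\<lambda>(\<omega>, s). H s \<omega>) \<in> borel_measurable (M \<Otimes>\<^sub>M borel)"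
    and H_adapted: "\<And>s. s \<in> {0..T} \<Longrightarrow> H s \<in> borel_measurable (F s)"
    and H_continuous: "AE \<omega> in M. continuous_on {0..T} (\<lambda>s. H s \<omega>)"
begin

text \<open>For continuous paths \<open>stay N s \<omega>\<close> means that \<open>\<bar>H\<bar>\<close> is at most \<open>N\<close> on all of \<open>[0, s]\<close>;
  quantifying over rational times keeps it measurable.\<close>

definition stay :: "real \<Rightarrow> real \<Rightarrow> 'a \<Rightarrow> bool" where
  "stay N s \<omega> \<longleftrightarrow> \<bar>H s \<omega>\<bar> \<le> N \<and>
    (\<forall>q :: rat. 0 \<le> real_of_rat q \<and> real_of_rat q \<le> s \<longrightarrow> \<bar>H (of_rat q) \<omega>\<bar> \<le> N)"

text \<open>Past the exit the value is 0 instead of being frozen. The bound by \<open>N\<close> then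
  holds even if \<open>\<bar>H 0\<bar>\<close> exceeds \<open>N\<close>, and the stopped process is
  dominated by \<open>\<bar>H\<bar>\<close>.\<close>

definition stopped :: "real \<Rightarrow> real \<Rightarrow> 'a \<Rightarrow> real" where
  "stopped N s \<omega> = (if stay N s \<omega> then H s \<omega> else 0)"

lemma measurable_H_comp [measurable (raw)]:
  assumes "f \<in> N \<rightarrow>\<^sub>M M" "g \<in> borel_measurable N"
  shows "(\<lambda>x. H (g x) (f x)) \<in> borel_measurable N"
  using measurable_compose[OF measurable_Pair[OF assms] H_joint] by simp

lemma stopped_joint: "(\<lambda>(\<omega>, s). stopped N s \<omega>) \<in> borel_measurable (M \<Otimes>\<^sub>M borel)"
  unfolding stopped_def stay_def by measurable

lemma measurable_stopped_comp [measurable (raw)]: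
  assumes "f \<in> N' \<rightarrow>\<^sub>M M" "g \<in> borel_measurable N'"
  shows "(\<lambda>x. stopped N (g x) (f x)) \<in> borel_measurable N'"
  using measurable_compose[OF measurable_Pair[OF assms] stopped_joint] by simp

lemma measurable_stay [measurable]: "Measurable.pred M (stay N s)"
  unfolding stay_def by measurable

text \<open>\<open>stay N s\<close> is a countable conjunction; the clause for a rational time in
  \<open>[0, s]\<close> is known at time \<open>s\<close>, and for all other rational times it is
  trivially true.\<close>

lemma stopped_adapted:
  assumes s: "s \<in> {0..T}"
  shows "stopped N s \<in> borel_measurable (F s)"
proof -
  have [measurable]: "H s \<in> borel_measurable (F s)" by (rule H_adapted[OF s])
  have "Measurable.pred (F s) (\<lambda>\<omega>. 0 \<le> real_of_rat q \<and> real_of_rat q \<le> s \<longrightarrow> \<bar>H (of_rat q) \<omega>\<bar> \<le> N)"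
    for q
  proof (cases "0 \<le> real_of_rat q \<and> real_of_rat q \<le> s")
    case True
    then have "H (of_rat q) \<in> borel_measurable (F (of_rat q))"
      using s by (intro H_adapted) auto
    from measurable_F_mono[OF this, of s] True
    have [measurable]: "H (of_rat q) \<in> borel_measurable (F s)" by simp
    show ?thesis by measurable
  next
    case False
    then have "(\<lambda>\<omega>. 0 \<le> real_of_rat q \<and> real_of_rat q \<le> s \<longrightarrow> \<bar>H (of_rat q) \<omega>\<bar> \<le> N) = (\<lambda>\<omega>. True)"
      by blast
    then show ?thesis by simp
  qed
  then have "Measurable.pred (F s) (\<lambda>\<omega>. \<forall>q :: rat. 0 \<le> real_of_rat q \<and> real_of_rat q \<le> s \<longrightarrow>
    \<bar>H (of_rat q) \<omega>\<bar> \<le> N)"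
    by (rule pred_intros_countable)
  moreover have "Measurable.pred (F s) (\<lambda>\<omega>. \<bar>H s \<omega>\<bar> \<le> N)" by measurable
  ultimately have "Measurable.pred (F s) (stay N s)"
    unfolding stay_def[abs_def] by (rule pred_intros_logic(3)[rotated])
  then show ?thesis unfolding stopped_def[abs_def] by measurable
qed

lemma abs_stopped_le: "0 \<le> N \<Longrightarrow> \<bar>stopped N s \<omega>\<bar> \<le> N"
  by (auto simp: stopped_def stay_def)

lemma abs_stopped_le_abs: "\<bar>stopped N s \<omega>\<bar> \<le> \<bar>H s \<omega>\<bar>"
  by (auto simp: stopped_def)

text \<open>Exceeding \<open>N\<close> is an open condition along a continuous path, so it persists
  just to the right of \<open>r\<close>, where there are rational times.\<close>

lemma rational_exceeds:
  assumes cont: "continuous_on {0..T} (\<lambda>s. H s \<omega>)" and r: "0 \<le> r" "r < s" "s \<le> T"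
    and N: "N < \<bar>H r \<omega>\<bar>"
  obtains q where "r < real_of_rat q" "real_of_rat q < s" "N < \<bar>H (of_rat q) \<omega>\<bar>"
proof -
  have "continuous (at r within {0..T}) (\<lambda>s. \<bar>H s \<omega>\<bar>)"
    using cont r by (intro continuous_rabs) (auto simp: continuous_on_eq_continuous_within)
  then have "\<forall>\<^sub>F x in at r within {0..T}. N < \<bar>H x \<omega>\<bar>"
    using N unfolding continuous_within by (rule order_tendstoD(1))
  then obtain d where d: "0 < d" "\<And>x. x \<in> {0..T} \<Longrightarrow> x \<noteq> r \<Longrightarrow> dist x r < d \<Longrightarrow> N < \<bar>H x \<omega>\<bar>"
    unfolding eventually_at by blast
  obtain q where q: "r < real_of_rat q" "real_of_rat q < min s (r + d)"
    using of_rat_dense[of r "min s (r + d)"] r d(1) by auto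
  then have "0 \<le> real_of_rat q" "real_of_rat q \<le> T" "real_of_rat q \<noteq> r" "dist (real_of_rat q) r < d"
    using r unfolding dist_real_def by linarith+
  then have "N < \<bar>H (of_rat q) \<omega>\<bar>" by (intro d(2)) simp_all
  then show ?thesis using q that by auto
qed

lemma stay_iff:
  assumes cont: "continuous_on {0..T} (\<lambda>s. H s \<omega>)" and s: "s \<in> {0..T}"
  shows "stay N s \<omega> \<longleftrightarrow> (\<forall>r\<in>{0..s}. \<bar>H r \<omega>\<bar> \<le> N)"
proof
  assume st: "stay N s \<omega>"
  show "\<forall>r\<in>{0..s}. \<bar>H r \<omega>\<bar> \<le> N"
  proof (rule ccontr)
    assume "\<not> (\<forall>r\<in>{0..s}. \<bar>H r \<omega>\<bar> \<le> N)"
    then obtain r where r: "0 \<le> r" "r \<le> s" "N < \<bar>H r \<omega>\<bar>" by (auto simp: not_le)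
    \<comment> \<open>The clause of \<open>stay\<close> for the time \<open>s\<close> itself
      excludes \<open>r = s\<close>, which leaves an interval to the right of \<open>r\<close> in
      which to pick a rational time.\<close>
    with st have "r \<noteq> s" by (auto simp: stay_def)
    with r obtain q where "r < real_of_rat q" "real_of_rat q < s" "N < \<bar>H (of_rat q) \<omega>\<bar>"
      using rational_exceeds[OF cont, of r s N] s by auto
    moreover from this have "0 \<le> real_of_rat q" "real_of_rat q \<le> s" using r by linarith+
    ultimately show False using st unfolding stay_def by (meson not_le)
  qed
next
  assume "\<forall>r\<in>{0..s}. \<bar>H r \<omega>\<bar> \<le> N"
  then show "stay N s \<omega>" using s by (auto simp: stay_def)
qed

lemma path_bounded:
  assumes cont: "continuous_on {0..T} (\<lambda>s. H s \<omega>)"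
  obtains C where "0 \<le> C" "\<And>s. s \<in> {0..T} \<Longrightarrow> \<bar>H s \<omega>\<bar> \<le> C"
proof -
  have "bounded ((\<lambda>s. H s \<omega>) ` {0..T})"
    by (intro compact_imp_bounded compact_continuous_image cont compact_Icc)
  then obtain C where "0 < C" "\<And>s. s \<in> {0..T} \<Longrightarrow> \<bar>H s \<omega>\<bar> \<le> C"
    unfolding bounded_pos by auto
  then show ?thesis by (intro that[of C]) auto
qed

lemma H_sequence:
  assumes cont: "continuous_on {0..T} (\<lambda>s. H s \<omega>)" and s: "s \<le> T"
    and l: "l \<longlonglongrightarrow> s" "\<And>k. 0 \<le> l k" "\<And>k. l k < s"
  shows "(\<lambda>k :: nat. H (l k) \<omega>) \<longlonglongrightarrow> H s \<omega>"
proof (rule continuous_on_tendsto_compose[OF cont l(1)])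
  have "0 \<le> s" using l by (meson order_trans less_imp_le)
  then show "s \<in> {0..T}" using s by auto
  show "\<forall>\<^sub>F k in sequentially. l k \<in> {0..T}"
    using s l(2,3) by (intro always_eventually) (auto intro: less_imp_le less_le_trans)
qed

text \<open>If the path has left the level by time \<open>s\<close>, it already did so at some time
  before \<open>s\<close>: otherwise \<open>\<bar>H s\<bar> \<le> N\<close> as a limit from the
  left. Hence the values before \<open>s\<close> are eventually 0. From the right the process may
  jump to 0.\<close>

lemma stopped_left_continuous:
  assumes cont: "continuous_on {0..T} (\<lambda>s. H s \<omega>)" and s: "s \<le> T"
    and l: "l \<longlonglongrightarrow> s" "\<And>k. 0 \<le> l k" "\<And>k. l k < s"
  shows "(\<lambda>k :: nat. stopped N (l k) \<omega>) \<longlonglongrightarrow> stopped N s \<omega>"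
proof -
  have s0: "0 < s" using l by (meson le_less_trans)
  note H = H_sequence[OF cont s l]
  have iff: "stay N (l k) \<omega> \<longleftrightarrow> (\<forall>r\<in>{0..l k}. \<bar>H r \<omega>\<bar> \<le> N)" for k
    using l(2,3)[of k] s by (intro stay_iff[OF cont]) auto
  have iff_s: "stay N s \<omega> \<longleftrightarrow> (\<forall>r\<in>{0..s}. \<bar>H r \<omega>\<bar> \<le> N)"
    using s s0 by (intro stay_iff[OF cont]) auto
  show ?thesis
  proof (cases "stay N s \<omega>")
    case True
    then have "stay N (l k) \<omega>" for k using l(3)[of k] unfolding iff iff_s by auto
    then show ?thesis using H True by (simp add: stopped_def)
  next
    case False
    have "\<exists>r\<ge>0. r < s \<and> N < \<bar>H r \<omega>\<bar>"
    proof (rule ccontr)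
      assume "\<not> ?thesis"
      then have le: "\<bar>H r \<omega>\<bar> \<le> N" if "0 \<le> r" "r < s" for r using that by (auto simp: not_less)
      have "\<bar>H s \<omega>\<bar> \<le> N"
        using l by (intro LIMSEQ_le_const2[OF tendsto_rabs[OF H]]) (auto intro!: le)
      then have "stay N s \<omega>" unfolding iff_s using le by (metis atLeastAtMost_iff order_le_less)
      with False show False ..
    qed
    then obtain r where r: "0 \<le> r" "r < s" "N < \<bar>H r \<omega>\<bar>" by auto
    have "\<forall>\<^sub>F k in sequentially. r < l k" using order_tendstoD(1)[OF l(1) r(2)] .
    then have "\<forall>\<^sub>F k in sequentially. stopped N (l k) \<omega> = 0"
    proof eventually_elim
      case (elim k)
      then have "\<not> stay N (l k) \<omega>" unfolding iff using r by (auto simp: not_le intro!: bexI[of _ r])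
      then show ?case by (simp add: stopped_def)
    qed
    then show ?thesis using False by (simp add: stopped_def tendsto_eventually)
  qed
qed

abbreviation stopped_sum :: "real \<Rightarrow> real \<Rightarrow> nat \<Rightarrow> 'a \<Rightarrow> real" where
  "stopped_sum N t k \<equiv> simple_ito_integral B (Suc k) (grid t k) (\<lambda>i. stopped N (grid t k i))"

lemma simple_process_stopped:
  assumes "0 \<le> N" "t \<in> {0..T}"
  shows "simple_process F t (Suc k) (grid t k) (\<lambda>i. stopped N (grid t k i))"
  unfolding simple_process_def
proof (intro conjI allI impI)
  fix i assume i: "i < Suc k"
  then have "grid t k i \<in> {0..T}" using grid_bounds[of t i k] assms by auto
  then show "stopped N (grid t k i) \<in> borel_measurable (F (grid t k i))" by (rule stopped_adapted)
  show "\<exists>C. \<forall>\<omega>\<in>space (F (grid t k i)). \<bar>stopped N (grid t k i) \<omega>\<bar> \<le> C"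
    using abs_stopped_le[OF assms(1)] by blast
qed (use assms in \<open>simp_all add: grid_ends grid_mono\<close>)

text \<open>The level \<open>real k\<close> keeps each simple process bounded, and on a given
  continuous path it eventually exceeds the maximum, so that the left-point values become those of
  \<open>H\<close>. A bound \<open>C\<close> of the path gives \<open>(2 * C)\<^sup>2\<close> as
  dominating constant for the energy.\<close>

lemma stopped_sum_limit:
  assumes ito: "has_ito_integral M F B t H I" and t: "t \<in> {0..T}"
  shows "converges_in_prob M (\<lambda>k. stopped_sum (real k) t k) I"
proof (rule has_ito_integral_limit[OF ito H_joint])
  show sp: "simple_process F t (Suc k) (grid t k) (\<lambda>i. stopped (real k) (grid t k i))" for k
    using t by (intro simple_process_stopped) auto
  define e where "e k = simple_eval (Suc k) (grid t k) (\<lambda>i. stopped (real k) (grid t k i))" for k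
  have [measurable]: "(\<lambda>(\<omega>, s). e k s \<omega>) \<in> borel_measurable (M \<Otimes>\<^sub>M borel)" for k
    unfolding e_def by (rule measurable_simple_eval_joint[OF sp])
  have "converges_in_prob M (\<lambda>k \<omega>. LBINT s:{0..t}. (e k s \<omega> - H s \<omega>)\<^sup>2) (\<lambda>_. 0)"
  proof (rule converges_in_prob_AE)
    show "(\<lambda>\<omega>. LBINT s:{0..t}. (e k s \<omega> - H s \<omega>)\<^sup>2) \<in> borel_measurable M" for k
      by (rule measurable_energy) measurable
    show "AE \<omega> in M. (\<lambda>k. LBINT s:{0..t}. (e k s \<omega> - H s \<omega>)\<^sup>2) \<longlonglongrightarrow> 0"
      using H_continuous AE_space
    proof eventually_elim
      case (elim \<omega>)
      note cont = elim(1)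
      have [measurable]: "(\<lambda>s. H s \<omega>) \<in> borel_measurable borel" "(\<lambda>s. e k s \<omega>) \<in> borel_measurable borel" for k
        using elim(2) unfolding e_def by measurable
      obtain C where C: "0 \<le> C" "\<And>s. s \<in> {0..T} \<Longrightarrow> \<bar>H s \<omega>\<bar> \<le> C"
        using path_bounded[OF cont] by metis
      have "(\<lambda>k. LBINT s:{0..t}. (e k s \<omega> - H s \<omega>)\<^sup>2) \<longlonglongrightarrow> (\<integral>(s::real). 0 \<partial>lborel)"
        unfolding set_lebesgue_integral_def
      proof (rule integral_dominated_convergence)
        show "integrable lborel (\<lambda>s. indicator {0..t} s * (2 * C)\<^sup>2)"
          using t by (intro integrable_mult_left integrable_real_indicator) simp_all
        show "AE s in lborel. (\<lambda>k. indicator {0..t} s *\<^sub>R (e k s \<omega> - H s \<omega>)\<^sup>2) \<longlonglongrightarrow> 0"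
          using AE_lborel_singleton[of 0]
        proof eventually_elim
          case (elim s)
          show ?case
          proof (cases "s \<in> {0..t}")
            case True
            with elim have s: "0 < s" "s \<le> t" by auto
            obtain i where i: "\<And>k. i k < Suc k" "\<And>k. s \<le> grid t k (Suc (i k))"
          and l: "(\<lambda>k. grid t k (i k)) \<longlonglongrightarrow> s" "\<And>k. 0 \<le> grid t k (i k)" "\<And>k. grid t k (i k) < s"
          using grid_left_points[OF s] by blast
            have ek: "e k s \<omega> = stopped (real k) (grid t k (i k)) \<omega>" for k
              unfolding e_def by (rule simple_eval_grid[OF _ i(1) l(3) i(2)]) (use t in simp)
            have "\<forall>\<^sub>F k in sequentially. C \<le> real k"
              using filterlim_real_sequentially by (simp add: filterlim_at_top)
            then have "\<forall>\<^sub>F k in sequentially. e k s \<omega> = H (grid t k (i k)) \<omega>"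
            proof eventually_elim
              case (elim k)
              have lk: "grid t k (i k) \<in> {0..T}" using l(2,3)[of k] s t by auto
              have "\<bar>H r \<omega>\<bar> \<le> real k" if "r \<in> {0..grid t k (i k)}" for r
                using C(2)[of r] elim that lk by auto
              then have "stay (real k) (grid t k (i k)) \<omega>" by (simp add: stay_iff[OF cont lk])
              then show ?case by (simp add: ek stopped_def)
            qed
            then have "(\<lambda>k. e k s \<omega>) \<longlonglongrightarrow> H s \<omega>"
              using H_sequence[OF cont _ l(1-3)] s t by (simp add: tendsto_cong)
            then have "(\<lambda>k. indicator {0..t} s *\<^sub>R (e k s \<omega> - H s \<omega>)\<^sup>2)
              \<longlonglongrightarrow> indicator {0..t} s *\<^sub>R (H s \<omega> - H s \<omega>)\<^sup>2"
              by (intro tendsto_intros)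
            then show ?thesis by simp
          qed simp
        qed
        fix k
        show "AE s in lborel. norm (indicator {0..t} s *\<^sub>R (e k s \<omega> - H s \<omega>)\<^sup>2)
          \<le> indicator {0..t} s * (2 * C)\<^sup>2"
          using AE_lborel_singleton[of 0]
        proof eventually_elim
          case (elim s)
          show ?case
          proof (cases "s \<in> {0..t}")
            case True
            with elim have s: "0 < s" "s \<le> t" by auto
            obtain i where i: "\<And>k. i k < Suc k" "\<And>k. s \<le> grid t k (Suc (i k))"
          and l: "(\<lambda>k. grid t k (i k)) \<longlonglongrightarrow> s" "\<And>k. 0 \<le> grid t k (i k)" "\<And>k. grid t k (i k) < s"
          using grid_left_points[OF s] by blast
            have "e k s \<omega> = stopped (real k) (grid t k (i k)) \<omega>"
              unfolding e_def by (rule simple_eval_grid[OF _ i(1) l(3) i(2)]) (use t in simp)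
            then have "\<bar>e k s \<omega>\<bar> \<le> C"
              using order_trans[OF abs_stopped_le_abs C(2)] l(2,3)[of k] s t by simp
            moreover have "\<bar>H s \<omega>\<bar> \<le> C" using C(2)[of s] s t by auto
            ultimately have "\<bar>e k s \<omega> - H s \<omega>\<bar> \<le> 2 * C" by linarith
            then have "(e k s \<omega> - H s \<omega>)\<^sup>2 \<le> (2 * C)\<^sup>2" 
              by (rule power2_le_iff_abs_le[THEN iffD2, rotated]) (use C in simp)
            then show ?thesis using True by simp
          qed simp
        qed
      qed measurable
      then show ?case by simp
    qed
  qed simp
  then show "converges_in_prob M (\<lambda>k \<omega>. LBINT s:{0..t}.
      (simple_eval (Suc k) (grid t k) (\<lambda>i. stopped (real k) (grid t k i)) s \<omega> - H s \<omega>)\<^sup>2) (\<lambda>_. 0)"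
    unfolding e_def .
qed

lemma measurable_stopped_sum [measurable]:
  assumes "0 \<le> N" "t \<in> {0..T}"
  shows "stopped_sum N t k \<in> borel_measurable M"
  using simple_process_stopped[OF assms] by (rule measurable_F[OF measurable_simple_ito_integral])

section \<open>Second moments of the stopped process and of the integral\<close>

definition stopped_moment :: "real \<Rightarrow> real \<Rightarrow> real" where
  "stopped_moment N s = expectation (\<lambda>\<omega>. (stopped N s \<omega>)\<^sup>2)"

lemma measurable_stopped_moment [measurable]: "stopped_moment N \<in> borel_measurable borel"
proof -
  have "(\<lambda>(s, \<omega>). (stopped N s \<omega>)\<^sup>2) \<in> borel_measurable (borel \<Otimes>\<^sub>M M)" by measurable
  then show ?thesis unfolding stopped_moment_def[abs_def] by (rule borel_measurable_lebesgue_integral)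
qed

lemma integrable_stopped_square:
  assumes "0 \<le> N"
  shows "integrable M (\<lambda>\<omega>. (stopped N s \<omega>)\<^sup>2)"
  using abs_stopped_le[OF assms] assms
  by (intro integrable_const_bound[of _ "N\<^sup>2"]) (simp_all add: power2_le_iff_abs_le)

lemma stopped_moment_bounds:
  assumes "0 \<le> N"
  shows "0 \<le> stopped_moment N s" "stopped_moment N s \<le> N\<^sup>2"
proof -
  show "0 \<le> stopped_moment N s" unfolding stopped_moment_def by simp
  have "stopped_moment N s \<le> expectation (\<lambda>_. N\<^sup>2)"
    unfolding stopped_moment_def using abs_stopped_le[OF assms] assms
    by (intro integral_mono integrable_stopped_square) (auto simp: power2_le_iff_abs_le)
  then show "stopped_moment N s \<le> N\<^sup>2" by (simp add: prob_space)
qed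

lemma stopped_moment_left_continuous:
  assumes N: "0 \<le> N" and s: "s \<le> T"
    and l: "l \<longlonglongrightarrow> s" "\<And>k. 0 \<le> l k" "\<And>k. l k < s"
  shows "(\<lambda>k :: nat. stopped_moment N (l k)) \<longlonglongrightarrow> stopped_moment N s"
  unfolding stopped_moment_def
proof (rule integral_dominated_convergence)
  show "AE \<omega> in M. (\<lambda>k. (stopped N (l k) \<omega>)\<^sup>2) \<longlonglongrightarrow> (stopped N s \<omega>)\<^sup>2"
    using H_continuous
  proof eventually_elim
    case (elim \<omega>)
    then show ?case by (intro tendsto_power stopped_left_continuous s l)
  qed
  show "AE \<omega> in M. norm ((stopped N (l k) \<omega>)\<^sup>2) \<le> N\<^sup>2" for k
    using abs_stopped_le[OF N] N by (simp add: power2_le_iff_abs_le)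
qed simp_all

text \<open>The event \<open>stay N t\<close> depends on the path up to \<open>t\<close> and so
  cannot be built into the coefficients, which must be known at the grid times. It multiplies the
  finished sums instead; this can only lower their second moment, which the isometry expresses as a
  Riemann sum of \<open>stopped_moment N\<close>.\<close>

lemma ito_integral_stay_le:
  assumes ito: "has_ito_integral M F B t H I" and t: "t \<in> {0..T}" and N: "0 \<le> N"
  shows "integrable M (\<lambda>\<omega>. (if stay N t \<omega> then I \<omega> else 0)\<^sup>2)"
    and "expectation (\<lambda>\<omega>. (if stay N t \<omega> then I \<omega> else 0)\<^sup>2) \<le> (LBINT s:{0..t}. stopped_moment N s)"
proof -
  have [measurable]: "I \<in> borel_measurable M" using ito unfolding has_ito_integral_def by blast
  have [measurable]: "stopped_sum N t k \<in> borel_measurable M" "stopped_sum (real k) t k \<in> borel_measurable M" for k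
    using N t by auto
  define X where "X k \<omega> = (if stay N t \<omega> then stopped_sum N t k \<omega> else 0)" for k \<omega>
  define c where "c k = (\<Sum>i<Suc k. stopped_moment N (grid t k i) * (grid t k (Suc i) - grid t k i))" for k
  have X[measurable]: "X k \<in> borel_measurable M" for k unfolding X_def by measurable
  note iso = simple_ito_isometry[OF simple_process_stopped[OF N t]]
  have int: "integrable M (\<lambda>\<omega>. (X k \<omega>)\<^sup>2)" for k
    by (rule Bochner_Integration.integrable_bound[OF iso(1)[of k]]) (auto simp: X_def)
  have "expectation (\<lambda>\<omega>. (X k \<omega>)\<^sup>2) \<le> expectation (\<lambda>\<omega>. (stopped_sum N t k \<omega>)\<^sup>2)" for k
    by (intro integral_mono int iso) (auto simp: X_def)
  then have le: "expectation (\<lambda>\<omega>. (X k \<omega>)\<^sup>2) \<le> c k" for k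
    unfolding iso(3) c_def stopped_moment_def .
  have c: "c \<longlonglongrightarrow> (LBINT s:{0..t}. stopped_moment N s)"
    unfolding c_def
  proof (rule riemann_sum_limit)
    show "\<bar>stopped_moment N s\<bar> \<le> N\<^sup>2" for s using stopped_moment_bounds[OF N, of s] by simp
  qed (use t N in \<open>auto intro!: stopped_moment_left_continuous\<close>)
  have lim: "converges_in_prob M X (\<lambda>\<omega>. if stay N t \<omega> then I \<omega> else 0)"
  proof (rule converges_in_prob_dominated[OF stopped_sum_limit[OF ito t]])
    have "\<forall>\<^sub>F k in sequentially. N \<le> real k"
      using filterlim_real_sequentially by (simp add: filterlim_at_top)
    then show "\<forall>\<^sub>F k in sequentially. AE \<omega> in M.
      \<bar>X k \<omega> - (if stay N t \<omega> then I \<omega> else 0)\<bar> \<le> \<bar>stopped_sum (real k) t k \<omega> - I \<omega>\<bar>"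
    proof eventually_elim
      case (elim k)
      note k = this
      show ?case using H_continuous
      proof eventually_elim
        case (elim \<omega>)
        show ?case
        proof (cases "stay N t \<omega>")
          case True
          have "stopped N (grid t k i) \<omega> = stopped (real k) (grid t k i) \<omega>" if "i < Suc k" for i
          proof -
            have g: "grid t k i \<in> {0..T}" "grid t k i \<le> t" using grid_bounds[of t i k] t that by auto
            have "\<forall>r\<in>{0..grid t k i}. \<bar>H r \<omega>\<bar> \<le> N"
              using True g unfolding stay_iff[OF elim t] by auto
            moreover from this have "\<forall>r\<in>{0..grid t k i}. \<bar>H r \<omega>\<bar> \<le> real k"
              using k by (meson order_trans)
            ultimately show ?thesis by (simp add: stopped_def stay_iff[OF elim g(1)])
          qed
          then have "stopped_sum N t k \<omega> = stopped_sum (real k) t k \<omega>"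
            by (simp add: simple_ito_integral_def)
          then show ?thesis using True by (simp add: X_def)
        qed (simp add: X_def)
      qed
    qed
  qed measurable
  have Y: "(\<lambda>\<omega>. if stay N t \<omega> then I \<omega> else 0) \<in> borel_measurable M" by measurable
  show "integrable M (\<lambda>\<omega>. (if stay N t \<omega> then I \<omega> else 0)\<^sup>2)"
    by (rule converges_in_prob_square_le(1)[OF lim X Y int le c])
  show "expectation (\<lambda>\<omega>. (if stay N t \<omega> then I \<omega> else 0)\<^sup>2) \<le> (LBINT s:{0..t}. stopped_moment N s)"
    by (rule converges_in_prob_square_le(2)[OF lim X Y int le c])
qed

text \<open>Stopping decreases \<open>\<bar>H\<bar>\<close>, so the isometry bounds the second
  moments of all the sums by \<open>C * t\<close>. This is the uniform bound under which their
  vanishing means pass to the limit.\<close>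

lemma ito_integral_expectation:
  assumes ito: "has_ito_integral M F B t H I" and t: "t \<in> {0..T}"
    and int: "\<And>s. s \<in> {0..T} \<Longrightarrow> integrable M (\<lambda>\<omega>. (H s \<omega>)\<^sup>2)"
    and le: "\<And>s. s \<in> {0..T} \<Longrightarrow> expectation (\<lambda>\<omega>. (H s \<omega>)\<^sup>2) \<le> C"
  shows "integrable M I" "expectation I = 0"
proof -
  have I[measurable]: "I \<in> borel_measurable M" using ito unfolding has_ito_integral_def by blast
  note iso = simple_ito_isometry[OF simple_process_stopped[OF of_nat_0_le_iff t]]
  have X: "stopped_sum (real k) t k \<in> borel_measurable M" for k
    using t by (intro measurable_stopped_sum) auto
  have bound: "expectation (\<lambda>\<omega>. (stopped_sum (real k) t k \<omega>)\<^sup>2) \<le> C * t" for k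
  proof -
    have "expectation (\<lambda>\<omega>. (stopped_sum (real k) t k \<omega>)\<^sup>2)
      = (\<Sum>i<Suc k. expectation (\<lambda>\<omega>. (stopped (real k) (grid t k i) \<omega>)\<^sup>2) * (grid t k (Suc i) - grid t k i))"
      by (rule iso(3))
    also have "\<dots> \<le> (\<Sum>i<Suc k. C * (grid t k (Suc i) - grid t k i))"
    proof (intro sum_mono mult_right_mono)
      fix i assume "i \<in> {..<Suc k}"
      then have g: "grid t k i \<in> {0..T}" using grid_bounds[of t i k] t by auto
      have "expectation (\<lambda>\<omega>. (stopped (real k) (grid t k i) \<omega>)\<^sup>2) \<le> expectation (\<lambda>\<omega>. (H (grid t k i) \<omega>)\<^sup>2)"
        by (intro integral_mono integrable_stopped_square int g) (auto simp: abs_le_square_iff[symmetric] abs_stopped_le_abs)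
      then show "expectation (\<lambda>\<omega>. (stopped (real k) (grid t k i) \<omega>)\<^sup>2) \<le> C" using le[OF g] by linarith
      show "0 \<le> grid t k (Suc i) - grid t k i" using grid_mono[of t i "Suc i" k] t by auto
    qed
    also have "\<dots> = C * t"
      unfolding sum_distrib_left[symmetric] by (subst sum_lessThan_telescope) (simp add: grid_ends)
    finally show ?thesis .
  qed
  note lim = stopped_sum_limit[OF ito t]
  have "integrable M (\<lambda>\<omega>. (I \<omega>)\<^sup>2)"
    by (rule converges_in_prob_square_le[OF lim X I iso(1) bound tendsto_const])
  then show "integrable M I" by (rule integrable_square_imp_integrable[OF I])
  have "(\<lambda>k. expectation (stopped_sum (real k) t k)) \<longlonglongrightarrow> expectation I"
    by (rule converges_in_prob_expectation[OF lim X I iso(1) bound])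
  then show "expectation I = 0" unfolding iso(2) by (simp add: LIMSEQ_const_iff)
qed

end

section \<open>The linear equation\<close>

text \<open>The Cauchy-Schwarz inequality against the constant 1, from the fact that the integral of
  \<open>(f s - m)\<^sup>2\<close> is nonnegative for every \<open>m\<close>; the best choice is the
  average \<open>m = ?L / t\<close>.\<close>

lemma set_integral_square_le:
  fixes f :: "real \<Rightarrow> real"
  assumes t: "0 \<le> t" and f: "set_integrable lborel {0..t} f"
    and f2: "set_integrable lborel {0..t} (\<lambda>s. (f s)\<^sup>2)"
  shows "(LBINT s:{0..t}. f s)\<^sup>2 \<le> t * (LBINT s:{0..t}. (f s)\<^sup>2)"
proof -
  let ?L = "LBINT s:{0..t}. f s" and ?A = "LBINT s:{0..t}. (f s)\<^sup>2"
  have quad: "0 \<le> ?A - 2 * m * ?L + m\<^sup>2 * t" for m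
  proof -
    have c: "set_integrable lborel {0..t} (\<lambda>_. m\<^sup>2)" "(LBINT s:{0..t}. m\<^sup>2) = m\<^sup>2 * t"
      using t by (auto simp: set_integrable_def set_lebesgue_integral_def)
    have g: "set_integrable lborel {0..t} (\<lambda>s. 2 * m * f s)" using f by simp
    have "0 \<le> (LBINT s:{0..t}. (f s - m)\<^sup>2)"
      unfolding set_lebesgue_integral_def by (intro Bochner_Integration.integral_nonneg) simp
    also have "(\<lambda>s. (f s - m)\<^sup>2) = (\<lambda>s. (f s)\<^sup>2 - 2 * m * f s + m\<^sup>2)"
      by (auto simp: power2_diff)
    also have "(LBINT s:{0..t}. (f s)\<^sup>2 - 2 * m * f s + m\<^sup>2) = ?A - 2 * m * ?L + m\<^sup>2 * t"
      using f2 g c by (simp add: set_integral_add set_integral_diff)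
    finally show ?thesis .
  qed
  show ?thesis
  proof (cases "t = 0")
    case True
    have "?L = 0"
    proof (rule ccontr)
      assume "?L \<noteq> 0"
      \<comment> \<open>For \<open>t = 0\<close> the expression is affine in \<open>m\<close>, and
        this \<open>m\<close> gives it the value -1.\<close>
      then show False using quad[of "(?A + 1) / (2 * ?L)"] True by simp
    qed
    then show ?thesis using True by simp
  next
    case False
    have "0 \<le> t * (?A - 2 * (?L / t) * ?L + (?L / t)\<^sup>2 * t)"
      using quad t by (intro mult_nonneg_nonneg)
    also have "\<dots> = t * ?A - ?L\<^sup>2"
      using False by (simp add: field_simps power2_eq_square)
    finally show ?thesis by simp
  qed
qed

text \<open>The uniform bound on the first absolute moments makes the function integrable on the
  product, so that Fubini's theorem applies.\<close>

lemma (in prob_space) expectation_set_integral: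
  fixes f :: "real \<Rightarrow> 'a \<Rightarrow> real"
  assumes f: "(\<lambda>(\<omega>, s). f s \<omega>) \<in> borel_measurable (M \<Otimes>\<^sub>M borel)" and t: "0 \<le> t"
    and int: "\<And>s. s \<in> {0..t} \<Longrightarrow> integrable M (f s)"
    and bound: "\<And>s. s \<in> {0..t} \<Longrightarrow> expectation (\<lambda>\<omega>. \<bar>f s \<omega>\<bar>) \<le> C"
  shows "integrable M (\<lambda>\<omega>. LBINT s:{0..t}. f s \<omega>)"
    and "expectation (\<lambda>\<omega>. LBINT s:{0..t}. f s \<omega>) = (LBINT s:{0..t}. expectation (f s))"
proof -
  interpret P: pair_sigma_finite lborel M ..
  define g where "g s \<omega> = indicator {0..t} s *\<^sub>R f s \<omega>" for s \<omega>
  have [measurable]: "(\<lambda>(s, \<omega>). f s \<omega>) \<in> borel_measurable (lborel \<Otimes>\<^sub>M M)"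
    using measurable_pair_swap[OF f] by simp
  have g[measurable]: "(\<lambda>(s, \<omega>). g s \<omega>) \<in> borel_measurable (lborel \<Otimes>\<^sub>M M)"
    unfolding g_def by measurable
  have "integrable (lborel \<Otimes>\<^sub>M M) (case_prod g)"
  proof (rule P.Fubini_integrable)
    show "AE s in lborel. integrable M (\<lambda>\<omega>. case_prod g (s, \<omega>))"
      using int by (intro AE_I2) (auto simp: g_def indicator_def)
    show "integrable lborel (\<lambda>s. \<integral>\<omega>. norm (case_prod g (s, \<omega>)) \<partial>M)"
    proof (rule Bochner_Integration.integrable_bound)
      show "integrable lborel (\<lambda>s. indicator {0..t} s * C)"
        using t by (intro integrable_mult_left integrable_real_indicator) simp_all
      show "AE s in lborel. norm (\<integral>\<omega>. norm (case_prod g (s, \<omega>)) \<partial>M) \<le> norm (indicator {0..t} s * C)"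
      proof (rule AE_I2)
        fix s
        show "norm (\<integral>\<omega>. norm (case_prod g (s, \<omega>)) \<partial>M) \<le> norm (indicator {0..t} s * C)"
        proof (cases "s \<in> {0..t}")
          case True
          have "0 \<le> expectation (\<lambda>\<omega>. \<bar>f s \<omega>\<bar>)" by simp
          with True bound[OF True] show ?thesis by (simp add: g_def)
        qed (simp add: g_def)
      qed
    qed measurable
  qed measurable
  note g_int = this
  have eq: "(\<integral>s. g s \<omega> \<partial>lborel) = (LBINT s:{0..t}. f s \<omega>)" for \<omega>
    by (simp add: g_def set_lebesgue_integral_def)
  show "integrable M (\<lambda>\<omega>. LBINT s:{0..t}. f s \<omega>)"
    using P.integrable_snd[OF g_int] unfolding eq .
  have "expectation (\<lambda>\<omega>. \<integral>s. g s \<omega> \<partial>lborel) = (\<integral>s. expectation (g s) \<partial>lborel)"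
    using P.Fubini_integral[OF g_int] .
  then show "expectation (\<lambda>\<omega>. LBINT s:{0..t}. f s \<omega>) = (LBINT s:{0..t}. expectation (f s))"
    unfolding eq by (simp add: g_def[abs_def] set_lebesgue_integral_def)
qed

text \<open>All clauses of the definition see the integrand at times in \<open>[0, t]\<close> only.
  This lets a process be exchanged for its extension to all real times.\<close>

lemma has_ito_integral_cong:
  assumes eq: "\<And>s \<omega>. s \<in> {0..t} \<Longrightarrow> H s \<omega> = H' s \<omega>" and H: "has_ito_integral M F B t H I"
  shows "has_ito_integral M F B t H' I"
proof -
  have "(\<lambda>(s, \<omega>). H s \<omega>) \<in> borel_measurable (restrict_space borel {0..t} \<Otimes>\<^sub>M M) \<longleftrightarrow>
    (\<lambda>(s, \<omega>). H' s \<omega>) \<in> borel_measurable (restrict_space borel {0..t} \<Otimes>\<^sub>M M)"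
    by (rule measurable_cong) (auto simp: space_pair_measure eq)
  moreover have "H s = H' s" if "s \<in> {0..t}" for s using eq[OF that] by auto
  moreover have "set_integrable lborel {0..t} (\<lambda>s. (H s \<omega>)\<^sup>2) \<longleftrightarrow>
    set_integrable lborel {0..t} (\<lambda>s. (H' s \<omega>)\<^sup>2)" for \<omega>
    by (rule set_integrable_cong) (simp_all add: eq)
  moreover have "(LBINT s:{0..t}. (h s - H s \<omega>)\<^sup>2) = (LBINT s:{0..t}. (h s - H' s \<omega>)\<^sup>2)" for h \<omega>
    by (rule set_lebesgue_integral_cong) (simp_all add: eq)
  ultimately show ?thesis
    using H unfolding has_ito_integral_def ito_integrand_def by simp
qed

section \<open>Moments of a solution of the linear equation\<close>

context continuous_adapted
begin

context
  fixes x \<mu> \<sigma> :: real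
  assumes T: "0 \<le> T" and sde: "\<And>t. t \<in> {0..T} \<Longrightarrow> \<exists>I. has_ito_integral M F B t H I \<and>
      (AE \<omega> in M. H t \<omega> = x + \<mu> * (LBINT s:{0..t}. H s \<omega>) + \<sigma> * I \<omega>)"
begin

text \<open>The factor 3 comes from squaring a sum of three terms, \<open>\<mu>\<^sup>2 * T\<close>
  from the Cauchy-Schwarz inequality for the drift with \<open>t \<le> T\<close>, and
  \<open>\<sigma>\<^sup>2\<close> from the bound for the Ito integral on \<open>stay N t\<close>.
  Off that event the left side vanishes.\<close>

lemma stopped_moment_integral_inequality:
  assumes N: "0 \<le> N" and t: "t \<in> {0..T}"
  shows "stopped_moment N t
    \<le> 3 * x\<^sup>2 + 3 * (\<mu>\<^sup>2 * T + \<sigma>\<^sup>2) * (LBINT s:{0..t}. stopped_moment N s)"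
proof -
  obtain I where ito: "has_ito_integral M F B t H I"
    and eq: "AE \<omega> in M. H t \<omega> = x + \<mu> * (LBINT s:{0..t}. H s \<omega>) + \<sigma> * I \<omega>"
    using sde[OF t] by blast
  note J = ito_integral_stay_le[OF ito t N]
  let ?J = "\<lambda>\<omega>. (if stay N t \<omega> then I \<omega> else 0)\<^sup>2"
  let ?Q = "\<lambda>\<omega>. LBINT s:{0..t}. (stopped N s \<omega>)\<^sup>2"
  have Q: "integrable M ?Q" "expectation ?Q = (LBINT s:{0..t}. stopped_moment N s)"
    unfolding stopped_moment_def
    by (rule expectation_set_integral[where C = "N\<^sup>2"];
        use t stopped_moment_bounds(2)[OF N] integrable_stopped_square[OF N] in
        \<open>simp_all add: stopped_moment_def\<close>)+
  have "AE \<omega> in M. (stopped N t \<omega>)\<^sup>2 \<le> 3 * x\<^sup>2 + 3 * \<mu>\<^sup>2 * T * ?Q \<omega> + 3 * \<sigma>\<^sup>2 * ?J \<omega>"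
    using eq H_continuous
  proof eventually_elim
    case (elim \<omega>)
    have Q0: "0 \<le> ?Q \<omega>"
      unfolding set_lebesgue_integral_def by (intro Bochner_Integration.integral_nonneg) simp
    show ?case
    proof (cases "stay N t \<omega>")
      case True
      let ?L = "LBINT s:{0..t}. H s \<omega>"
      have cont: "continuous_on {0..t} (\<lambda>s. H s \<omega>)"
        using t by (intro continuous_on_subset[OF elim(2)]) auto
      have st: "stopped N s \<omega> = H s \<omega>" if "s \<in> {0..t}" for s
      proof -
        have "s \<in> {0..T}" using that t by auto
        then show ?thesis
          using True that unfolding stopped_def stay_iff[OF elim(2) t] by (simp add: stay_iff[OF elim(2)])
      qed
      have "?L\<^sup>2 \<le> t * (LBINT s:{0..t}. (H s \<omega>)\<^sup>2)"
        using t cont by (intro set_integral_square_le borel_integrable_atLeastAtMost')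
          (auto intro!: continuous_intros)
      also have "(LBINT s:{0..t}. (H s \<omega>)\<^sup>2) = ?Q \<omega>"
        by (rule set_lebesgue_integral_cong) (simp_all add: st)
      also have "t * ?Q \<omega> \<le> T * ?Q \<omega>" using t Q0 by (intro mult_right_mono) auto
      finally have L: "\<mu>\<^sup>2 * ?L\<^sup>2 \<le> \<mu>\<^sup>2 * (T * ?Q \<omega>)" by (intro mult_left_mono) auto
      have sq: "(a + b + c)\<^sup>2 \<le> 3 * a\<^sup>2 + 3 * b\<^sup>2 + 3 * c\<^sup>2" for a b c :: real
        using zero_le_power2[of "a - b"] zero_le_power2[of "b - c"] zero_le_power2[of "a - c"]
        by (simp add: power2_eq_square algebra_simps)
      have "(stopped N t \<omega>)\<^sup>2 = (x + \<mu> * ?L + \<sigma> * I \<omega>)\<^sup>2"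
        using elim(1) True by (simp add: stopped_def)
      also have "\<dots> \<le> 3 * x\<^sup>2 + 3 * (\<mu> * ?L)\<^sup>2 + 3 * (\<sigma> * I \<omega>)\<^sup>2" by (rule sq)
      finally show ?thesis using L True by (simp add: power_mult_distrib mult.assoc)
    next
      case False
      have "0 \<le> 3 * x\<^sup>2 + 3 * \<mu>\<^sup>2 * T * ?Q \<omega>" using Q0 T by (intro add_nonneg_nonneg mult_nonneg_nonneg) auto
      then show ?thesis using False by (simp add: stopped_def)
    qed
  qed
  then have "stopped_moment N t \<le> expectation (\<lambda>\<omega>. 3 * x\<^sup>2 + 3 * \<mu>\<^sup>2 * T * ?Q \<omega> + 3 * \<sigma>\<^sup>2 * ?J \<omega>)"
    unfolding stopped_moment_def
    using Q(1) J(1) integrable_stopped_square[OF N]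
    by (intro integral_mono_AE Bochner_Integration.integrable_add integrable_mult_right integrable_const)
  also have "\<dots> = 3 * x\<^sup>2 + 3 * \<mu>\<^sup>2 * T * expectation ?Q + 3 * \<sigma>\<^sup>2 * expectation ?J"
    using Q(1) J(1) by (simp add: prob_space)
  also have "\<dots> \<le> 3 * x\<^sup>2 + 3 * \<mu>\<^sup>2 * T * expectation ?Q + 3 * \<sigma>\<^sup>2 * (LBINT s:{0..t}. stopped_moment N s)"
    using J(2) by (intro add_left_mono mult_left_mono) auto
  finally show ?thesis unfolding Q(2) by (simp add: algebra_simps)
qed

text \<open>Each stopped moment is at most the square of its level. This bound grows with the level,
  but it admits Gronwall's lemma, whose bound does not; as the level tends to infinity, Fatou's
  lemma passes to \<open>H\<close>.\<close>

lemma H_square_bounded: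
  assumes \<sigma>: "\<sigma> \<noteq> 0"
  obtains C where "\<And>t. t \<in> {0..T} \<Longrightarrow> integrable M (\<lambda>\<omega>. (H t \<omega>)\<^sup>2)"
    and "\<And>t. t \<in> {0..T} \<Longrightarrow> expectation (\<lambda>\<omega>. (H t \<omega>)\<^sup>2) \<le> C"
proof -
  define b where "b = 3 * (\<mu>\<^sup>2 * T + \<sigma>\<^sup>2)"
  define C where "C = 2 * (3 * x\<^sup>2) * exp (2 * b * T)"
  have b: "0 < b" using T \<sigma> unfolding b_def by (intro mult_pos_pos add_nonneg_pos) auto
  have bound: "stopped_moment (real k) t \<le> C" if t: "t \<in> {0..T}" for k t
  proof -
    have "stopped_moment (real k) t \<le> 2 * (3 * x\<^sup>2) * exp (2 * b * t)"
    proof (rule gronwall_bounded[OF _ _ _ _ b _ t])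
      show "set_integrable lborel {0..T} (stopped_moment (real k))"
        unfolding set_integrable_def using T stopped_moment_bounds[of "real k"]
        by (intro integrableI_bounded_set_indicator[where B = "(real k)\<^sup>2"]) auto
    qed (use stopped_moment_bounds[of "real k"] stopped_moment_integral_inequality[of "real k"] in
        \<open>auto simp: b_def\<close>)
    also have "\<dots> \<le> C" unfolding C_def using t b by (intro mult_left_mono) auto
    finally show ?thesis .
  qed
  have *: "integrable M (\<lambda>\<omega>. (H t \<omega>)\<^sup>2) \<and> expectation (\<lambda>\<omega>. (H t \<omega>)\<^sup>2) \<le> C" if t: "t \<in> {0..T}" for t
  proof -
    have meas: "stopped (real k) t \<in> borel_measurable M" "H t \<in> borel_measurable M" for k by measurable
    have "AE \<omega> in M. (\<lambda>k. stopped (real k) t \<omega>) \<longlonglongrightarrow> H t \<omega>"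
      using H_continuous
    proof eventually_elim
      case (elim \<omega>)
      obtain D where D: "\<And>s. s \<in> {0..T} \<Longrightarrow> \<bar>H s \<omega>\<bar> \<le> D" using path_bounded[OF elim] by blast
      have "\<forall>\<^sub>F k in sequentially. D \<le> real k"
        using filterlim_real_sequentially by (simp add: filterlim_at_top)
      then have "\<forall>\<^sub>F k in sequentially. stopped (real k) t \<omega> = H t \<omega>"
      proof eventually_elim
        case (elim k)
        have "\<bar>H r \<omega>\<bar> \<le> real k" if "r \<in> {0..t}" for r using D[of r] elim that t by auto
        then show ?case by (simp add: stopped_def stay_iff[OF \<open>continuous_on {0..T} (\<lambda>s. H s \<omega>)\<close> t])
      qed
      then show ?case by (rule tendsto_eventually)
    qed
    then have lim: "converges_in_prob M (\<lambda>k. stopped (real k) t) (H t)"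
      by (intro converges_in_prob_AE meas)
    have "expectation (\<lambda>\<omega>. (stopped (real k) t \<omega>)\<^sup>2) \<le> C" for k
      using bound[OF t, of k] by (simp add: stopped_moment_def)
    from converges_in_prob_square_le[OF lim meas integrable_stopped_square[OF of_nat_0_le_iff]
        this tendsto_const]
    show ?thesis by blast
  qed
  show ?thesis by (rule that[of C]) (use * in auto)
qed

text \<open>The second moment bound serves twice: it gives the Ito integral mean 0 and, through
  \<open>\<bar>H s\<bar> \<le> 1 + (H s)\<^sup>2\<close>, it allows expectation and time integral to
  be exchanged in the drift.\<close>

lemma linear_sde_expectation:
  assumes \<mu>: "0 < \<mu>" and \<sigma>: "\<sigma> \<noteq> 0" and t: "t \<in> {0..T}"
  shows "integrable M (H t)" "expectation (H t) = x * exp (\<mu> * t)"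
proof -
  obtain C where int2: "\<And>t. t \<in> {0..T} \<Longrightarrow> integrable M (\<lambda>\<omega>. (H t \<omega>)\<^sup>2)"
    and le: "\<And>t. t \<in> {0..T} \<Longrightarrow> expectation (\<lambda>\<omega>. (H t \<omega>)\<^sup>2) \<le> C"
    using H_square_bounded[OF \<sigma>] by blast
  have meas: "H s \<in> borel_measurable M" for s by measurable
  have int: "integrable M (H s)" if "s \<in> {0..T}" for s
    by (rule integrable_square_imp_integrable[OF meas int2[OF that]])
  show "integrable M (H t)" by (rule int[OF t])
  have abs_le: "expectation (\<lambda>\<omega>. \<bar>H s \<omega>\<bar>) \<le> 1 + C" if s: "s \<in> {0..T}" for s
  proof -
    have "expectation (\<lambda>\<omega>. \<bar>H s \<omega>\<bar>) \<le> expectation (\<lambda>\<omega>. 1 + (H s \<omega>)\<^sup>2)"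
    proof (intro integral_mono integrable_abs int s Bochner_Integration.integrable_add integrable_const int2)
      fix \<omega>
      have "0 \<le> (\<bar>H s \<omega>\<bar> - 1)\<^sup>2" by simp
      then have "2 * \<bar>H s \<omega>\<bar> \<le> 1 + (H s \<omega>)\<^sup>2" by (simp add: power2_diff)
      then show "\<bar>H s \<omega>\<bar> \<le> 1 + (H s \<omega>)\<^sup>2" by simp
    qed
    also have "\<dots> = 1 + expectation (\<lambda>\<omega>. (H s \<omega>)\<^sup>2)" using int2[OF s] by (simp add: prob_space)
    finally show ?thesis using le[OF s] by simp
  qed
  define e where "e s = expectation (H s)" for s
  have [measurable]: "e \<in> borel_measurable borel"
  proof -
    have "(\<lambda>(s, \<omega>). H s \<omega>) \<in> borel_measurable (borel \<Otimes>\<^sub>M M)" by measurable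
    then show ?thesis unfolding e_def[abs_def] by (rule borel_measurable_lebesgue_integral)
  qed
  have e_bound: "\<bar>e s\<bar> \<le> 1 + C" if "s \<in> {0..T}" for s
    using integral_abs_bound[of M "H s"] abs_le[OF that] unfolding e_def by linarith
  have e_int: "set_integrable lborel {0..r} e" if "r \<in> {0..T}" for r
    unfolding set_integrable_def using that e_bound
    by (intro integrableI_bounded_set_indicator[where B = "1 + C"]) auto
  have e_eq: "e r = x + \<mu> * (LBINT s:{0..r}. e s)" if r: "r \<in> {0..T}" for r
  proof -
    obtain I where ito: "has_ito_integral M F B r H I"
      and eq: "AE \<omega> in M. H r \<omega> = x + \<mu> * (LBINT s:{0..r}. H s \<omega>) + \<sigma> * I \<omega>"
      using sde[OF r] by blast
    have I: "integrable M I" "expectation I = 0"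
      using ito_integral_expectation[OF ito r int2 le] by simp_all
    have L: "integrable M (\<lambda>\<omega>. LBINT s:{0..r}. H s \<omega>)"
      "expectation (\<lambda>\<omega>. LBINT s:{0..r}. H s \<omega>) = (LBINT s:{0..r}. e s)"
      unfolding e_def using r by (auto intro!: expectation_set_integral[OF H_joint] int abs_le)
    have "e r = expectation (\<lambda>\<omega>. x + \<mu> * (LBINT s:{0..r}. H s \<omega>) + \<sigma> * I \<omega>)"
      unfolding e_def
    proof (rule integral_cong_AE[OF meas _ eq])
      note [measurable] = borel_measurable_integrable[OF L(1)] borel_measurable_integrable[OF I(1)]
      show "(\<lambda>\<omega>. x + \<mu> * (LBINT s:{0..r}. H s \<omega>) + \<sigma> * I \<omega>) \<in> borel_measurable M" by measurable
    qed
    also have "\<dots> = x + \<mu> * (LBINT s:{0..r}. e s)"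
      using L I by (simp add: prob_space)
    finally show ?thesis .
  qed
  define h where "h s = \<bar>e s - x * exp (\<mu> * s)\<bar>" for s
  have exp_int: "set_integrable lborel {0..r} (\<lambda>s. x * exp (\<mu> * s))" if "r \<in> {0..T}" for r
    using integral_exp_Icc(1)[of \<mu> r] \<mu> that by simp
  have h_int: "set_integrable lborel {0..r} h" if "r \<in> {0..T}" for r
    unfolding h_def by (intro set_integrable_abs set_integral_diff e_int exp_int that)
  \<comment> \<open>The mean and the exponential solve the same linear integral equation, so their
    difference has constant term 0 and the Gronwall bound is 0.\<close>
  have "h t \<le> 2 * 0 * exp (2 * \<mu> * t)"
  proof (rule gronwall_bounded[OF h_int _ _ _ \<mu> _ t])
    fix r assume r: "r \<in> {0..T}"
    show "h r \<le> 1 + C + \<bar>x\<bar> * exp (\<mu> * T)"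
    proof -
      have "\<bar>x * exp (\<mu> * r)\<bar> \<le> \<bar>x\<bar> * exp (\<mu> * T)"
        using r \<mu> by (simp add: abs_mult mult_left_mono)
      then show ?thesis using e_bound[OF r] unfolding h_def by linarith
    qed
    have "exp (\<mu> * r) = 1 + \<mu> * (LBINT s:{0..r}. exp (\<mu> * s))"
      using integral_exp_Icc(2)[of \<mu> r] \<mu> r by simp
    then have "x * exp (\<mu> * r) = x * (1 + \<mu> * (LBINT s:{0..r}. exp (\<mu> * s)))" by simp
    also have "\<dots> = x + \<mu> * (LBINT s:{0..r}. x * exp (\<mu> * s))" by (simp add: algebra_simps)
    finally have "x * exp (\<mu> * r) = x + \<mu> * (LBINT s:{0..r}. x * exp (\<mu> * s))" .
    then have "e r - x * exp (\<mu> * r) = \<mu> * (LBINT s:{0..r}. e s - x * exp (\<mu> * s))"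
      unfolding set_integral_diff(2)[OF e_int[OF r] exp_int[OF r]] right_diff_distrib
      using e_eq[OF r] by linarith
    then have "h r = \<mu> * \<bar>LBINT s:{0..r}. e s - x * exp (\<mu> * s)\<bar>"
      using \<mu> by (simp add: h_def abs_mult)
    also have "\<bar>LBINT s:{0..r}. e s - x * exp (\<mu> * s)\<bar> \<le> (LBINT s:{0..r}. h s)"
      using set_integral_norm_bound[OF set_integral_diff(1)[OF e_int[OF r] exp_int[OF r]]]
      by (simp add: h_def)
    finally show "h r \<le> 0 + \<mu> * (LBINT s:{0..r}. h s)" using \<mu> by (simp add: mult_left_mono)
  qed (use T in \<open>auto simp: h_def\<close>)
  then show "expectation (H t) = x * exp (\<mu> * t)" by (simp add: h_def e_def)
qed

end

end

text \<open>The product of \<open>f\<close> with \<open>exp (- c * s)\<close> has derivative 0 on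
  the interval and is therefore constant.\<close>

lemma exponential_growth_unique:
  fixes f :: "real \<Rightarrow> real"
  assumes "\<And>t. t \<in> {0..T} \<Longrightarrow> (f has_real_derivative c * f t) (at t within {0..T})" "t \<in> {0..T}"
  shows "f t = f 0 * exp (c * t)"
proof -
  have "((\<lambda>s. f s * exp (- c * s)) has_real_derivative 0) (at s within {0..T})"
    if "s \<in> {0..T}" for s
    using assms(1)[OF that] by (auto intro!: derivative_eq_intros simp: algebra_simps)
  then obtain k where k: "\<And>s. s \<in> {0..T} \<Longrightarrow> f s * exp (- c * s) = k"
    using has_field_derivative_zero_constant[of "{0..T}" "\<lambda>s. f s * exp (- c * s)"] by auto
  have "f t * exp (- c * t) = f 0" using k[of t] k[of 0] assms(2) by auto
  then show ?thesis by (simp add: exp_minus field_simps)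
qed

theorem theorem1p1:
  fixes M0 M1 \<rho> \<mu> \<sigma> T :: real
    and M :: "'a measure" and F :: "real \<Rightarrow> 'a measure"
    and B :: "real \<Rightarrow> 'a \<Rightarrow> real"
    and S0 :: "real \<Rightarrow> real" and S1 S :: "real \<Rightarrow> 'a \<Rightarrow> real"
  assumes pos: "M0 > 0" "M1 > 0" "\<rho> > 0" "\<mu> > 0" "\<sigma> > 0" "T > 0"
    and B: "brownian_motion M F B"
    and S0_ode: "\<And>t. t \<in> {0..T} \<Longrightarrow> (S0 has_real_derivative \<rho> * S0 t) (at t within {0..T})"
    and S0_init: "S0 0 = M0"
    and S1_sde: "ito_sde_solution M F B (\<lambda>x. \<mu> * x) (\<lambda>x. \<sigma> * x) M1 T S1"
    and S_total: "\<And>t \<omega>. t \<in> {0..T} \<Longrightarrow> \<omega> \<in> space M \<Longrightarrow> S t \<omega> = S0 t + S1 t \<omega>"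
  shows "prob_space.expectation M (S T) = M0 * exp (\<rho> * T) + M1 * exp (\<mu> * T)"
proof -
  interpret brownian_motion M F B by fact
  \<comment> \<open>Joint measurability is given on \<open>[0, T]\<close>. Clamping the time
    produces a process on the whole real line with the same values on \<open>[0, T]\<close>.\<close>
  define c where "c s = max 0 (min T s)" for s :: real
  have c: "c s \<in> {0..T}" "s \<in> {0..T} \<Longrightarrow> c s = s" for s using pos by (auto simp: c_def)
  define H where "H s \<omega> = \<sigma> * S1 (c s) \<omega>" for s \<omega>
  have H_eq: "H s \<omega> = \<sigma> * S1 s \<omega>" if "s \<in> {0..T}" for s \<omega> using c(2)[OF that] by (simp add: H_def)
  from S1_sde have adapted: "\<And>t. t \<in> {0..T} \<Longrightarrow> S1 t \<in> borel_measurable (F t)"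
    and cont: "AE \<omega> in M. continuous_on {0..T} (\<lambda>t. S1 t \<omega>)"
    and sol: "\<And>t. t \<in> {0..T} \<Longrightarrow> \<exists>I. has_ito_integral M F B t (\<lambda>s \<omega>. \<sigma> * S1 s \<omega>) I \<and>
      (AE \<omega> in M. S1 t \<omega> = M1 + (LBINT s:{0..t}. \<mu> * S1 s \<omega>) + I \<omega>)"
    unfolding ito_sde_solution_def by blast+
  \<comment> \<open>The equation at the final time \<open>T\<close> is the one whose integrand is
    jointly measurable on all of \<open>[0, T]\<close>.\<close>
  have joint: "(\<lambda>(s, \<omega>). \<sigma> * S1 s \<omega>) \<in> borel_measurable (restrict_space borel {0..T} \<Otimes>\<^sub>M M)"
    using sol[of T] pos unfolding has_ito_integral_def ito_integrand_def by auto
  interpret continuous_adapted M F B H T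
  proof
    have "c \<in> borel \<rightarrow>\<^sub>M restrict_space borel {0..T}"
      using c(1) unfolding c_def by (intro measurable_restrict_space2) auto
    then have "(\<lambda>x. (c (snd x), fst x)) \<in> M \<Otimes>\<^sub>M borel \<rightarrow>\<^sub>M restrict_space borel {0..T} \<Otimes>\<^sub>M M"
      by measurable
    from measurable_compose[OF this joint]
    show "(\<lambda>(\<omega>, s). H s \<omega>) \<in> borel_measurable (M \<Otimes>\<^sub>M borel)"
      by (simp add: H_def split_beta')
    show "H s \<in> borel_measurable (F s)" if "s \<in> {0..T}" for s
      using adapted[OF that] c(2)[OF that] unfolding H_def by simp
    show "AE \<omega> in M. continuous_on {0..T} (\<lambda>s. H s \<omega>)"
      using cont
    proof eventually_elim
      case (elim \<omega>)
      then have "continuous_on {0..T} (\<lambda>s. \<sigma> * S1 s \<omega>)" by (intro continuous_intros)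
      then show ?case by (rule continuous_on_eq) (simp add: H_eq)
    qed
  qed
  \<comment> \<open>\<open>I\<close> remains the integral of \<open>\<sigma> * S1\<close>, so
    multiplying the equation by \<sigma> leaves a further factor \<sigma> in front of it.\<close>
  have sde: "\<exists>I. has_ito_integral M F B t H I \<and>
      (AE \<omega> in M. H t \<omega> = \<sigma> * M1 + \<mu> * (LBINT s:{0..t}. H s \<omega>) + \<sigma> * I \<omega>)"
    if t: "t \<in> {0..T}" for t
  proof -
    obtain I where I: "has_ito_integral M F B t (\<lambda>s \<omega>. \<sigma> * S1 s \<omega>) I"
      and eq: "AE \<omega> in M. S1 t \<omega> = M1 + (LBINT s:{0..t}. \<mu> * S1 s \<omega>) + I \<omega>"
      using sol[OF t] by blast
    have "has_ito_integral M F B t H I"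
      using t by (intro has_ito_integral_cong[OF _ I]) (simp add: H_eq)
    moreover have "AE \<omega> in M. H t \<omega> = \<sigma> * M1 + \<mu> * (LBINT s:{0..t}. H s \<omega>) + \<sigma> * I \<omega>"
      using eq
    proof eventually_elim
      case (elim \<omega>)
      have "(LBINT s:{0..t}. H s \<omega>) = (LBINT s:{0..t}. \<sigma> * S1 s \<omega>)"
        using t by (intro set_lebesgue_integral_cong) (auto simp: H_eq)
      then show ?case unfolding H_eq[OF t] elim by (simp add: algebra_simps)
    qed
    ultimately show ?thesis by blast
  qed
  have T: "T \<in> {0..T}" "0 \<le> T" using pos by auto
  note HT = linear_sde_expectation[OF T(2) sde pos(4) _ T(1)]
  have S1: "S1 T \<omega> = H T \<omega> / \<sigma>" for \<omega> using H_eq[OF T(1)] pos by simp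
  have "expectation (S T) = expectation (\<lambda>\<omega>. S0 T + H T \<omega> / \<sigma>)"
    by (intro Bochner_Integration.integral_cong refl) (simp add: S_total[OF T(1)] S1)
  also have "\<dots> = S0 T + expectation (H T) / \<sigma>"
    using HT(1) pos by (simp add: prob_space)
  also have "\<dots> = M0 * exp (\<rho> * T) + M1 * exp (\<mu> * T)"
    using HT(2) exponential_growth_unique[OF S0_ode T(1)] pos S0_init by simp
  finally show ?thesis .
qed

end
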